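(* Let $G$ be a subcubic graph. 1. If $\mathrm{mad}(G)<\frac{7}{3}$, then $\chi'_{\mathrm{inj}}(G)\leq 4$. 2. If $\mathrm{mad}(G)<\frac{8}{3}$, then $\chi'_{\mathrm{inj}}(G)\leq 6$. 3. If $\mathrm{mad}(G)<3$, then $\chi'_{\mathrm{inj}}(G)\leq 7$.
   Context: All graphs are finite and simple. A graph is subcubic if its maximum degree is at most $3$. The maximum average degree of $G$ is $\mathrm{mad}(G)=\max\left\{\frac{2|E(H)|}{|V(H)|} : H\subseteq G\right\}$, the maximum being over the (nonempty) subgraphs $H$ of $G$. Three edges $e_1,e_2,e_3$ of a graph are consecutive if they form (in this order) a path of length three or a cycle of length three. An injective edge-coloring of $G$ with $k$ colors is a map $c:E(G)\to\{1,\dots,k\}$ (not necessarily a proper edge-coloring) such that $c(e_1)\neq c(e_3)$ whenever $e_1,e_2,e_3$ are consecutive edges in $G$. The injective chromatic index $\chi'_{\mathrm{inj}}(G)$ is the minimum $k$ such that $G$ has an injective edge-coloring with $k$ colors. *)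

theory Defs
  imports Complex_Main "HOL-Library.FuncSet"
begin

definition simple_graph :: "'a set \<Rightarrow> 'a set set \<Rightarrow> bool" where
  "simple_graph V E \<longleftrightarrow> finite V \<and> (\<forall>e\<in>E. e \<subseteq> V \<and> card e = 2)"

definition subgraph :: "'a set \<Rightarrow> 'a set set \<Rightarrow> 'a set \<Rightarrow> 'a set set \<Rightarrow> bool" where
  "subgraph W F V E \<longleftrightarrow> simple_graph W F \<and> W \<subseteq> V \<and> F \<subseteq> E"

definition degree :: "'a set set \<Rightarrow> 'a \<Rightarrow> nat" where
  "degree E v = card {e \<in> E. v \<in> e}"

text \<open>
  In \<open>max_degree\<close> and \<open>mad\<close>, the inserted \<open>0\<close> only fixes the value for the graph without
  vertices. For a nonempty graph it changes nothing: the other members are nonnegative and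
  exist (for \<open>mad\<close>, a single vertex without edges is a nonempty subgraph).
\<close>

definition max_degree :: "'a set \<Rightarrow> 'a set set \<Rightarrow> nat" where
  "max_degree V E = Max (insert 0 (degree E ` V))"

definition subcubic :: "'a set \<Rightarrow> 'a set set \<Rightarrow> bool" where
  "subcubic V E \<longleftrightarrow> max_degree V E \<le> 3"

definition mad :: "'a set \<Rightarrow> 'a set set \<Rightarrow> real" where
  "mad V E = Max (insert 0 {2 * real (card F) / real (card W) | W F. subgraph W F V E \<and> W \<noteq> {}})"

text \<open>First disjunct: a path of length three; second disjunct: a cycle of length three.\<close>

definition consecutive :: "'a set set \<Rightarrow> 'a set \<Rightarrow> 'a set \<Rightarrow> 'a set \<Rightarrow> bool" where
  "consecutive E e1 e2 e3 \<longleftrightarrow> e1 \<in> E \<and> e2 \<in> E \<and> e3 \<in> E \<and>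
     ((\<exists>a b c d. distinct [a, b, c, d] \<and> e1 = {a, b} \<and> e2 = {b, c} \<and> e3 = {c, d}) \<or>
      (\<exists>a b c. distinct [a, b, c] \<and> e1 = {a, b} \<and> e2 = {b, c} \<and> e3 = {c, a}))"

definition injective_edge_coloring :: "'a set set \<Rightarrow> nat \<Rightarrow> ('a set \<Rightarrow> nat) \<Rightarrow> bool" where
  "injective_edge_coloring E k col \<longleftrightarrow>
     col \<in> E \<rightarrow> {1..k} \<and> (\<forall>e1 e2 e3. consecutive E e1 e2 e3 \<longrightarrow> col e1 \<noteq> col e3)"

definition inj_chromatic_index :: "'a set set \<Rightarrow> nat" where
  "inj_chromatic_index E = (LEAST k. \<exists>col. injective_edge_coloring E k col)"

text \<open>The maximum in \<open>mad\<close> ranges over a finite set and the minimum in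
  \<open>inj_chromatic_index\<close> over a nonempty one, so both are attained.\<close>

lemma simple_graph_finite_edges: "simple_graph V E \<Longrightarrow> finite E"
  by (rule finite_subset[of E "Pow V"]) (auto simp: simple_graph_def)

lemma finite_mad_values:
  assumes "simple_graph V E"
  shows "finite {2 * real (card F) / real (card W) | W F. subgraph W F V E \<and> W \<noteq> {}}"
proof (rule finite_subset)
  show "{2 * real (card F) / real (card W) | W F. subgraph W F V E \<and> W \<noteq> {}}
    \<subseteq> (\<lambda>(W, F). 2 * real (card F) / real (card W)) ` (Pow V \<times> Pow E)"
    by (auto simp: subgraph_def image_iff)
  show "finite ((\<lambda>(W, F). 2 * real (card F) / real (card W)) ` (Pow V \<times> Pow E))"
    using assms simple_graph_finite_edges[OF assms] by (auto simp: simple_graph_def)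
qed

lemma injective_edge_coloring_exists:
  assumes "simple_graph V E"
  shows "\<exists>k col. injective_edge_coloring E k col"
proof -
  obtain f where f: "bij_betw f E {1..card E}"
    using finite_same_card_bij[of E "{1..card E}"] simple_graph_finite_edges[OF assms] by auto
  have ne: "e1 \<noteq> e3" if "consecutive E e1 e2 e3" for e1 e2 e3
    using that unfolding consecutive_def by (auto simp: doubleton_eq_iff)
  have "f e1 \<noteq> f e3" if "consecutive E e1 e2 e3" for e1 e2 e3
    using ne[OF that] that f unfolding consecutive_def bij_betw_def inj_on_def by blast
  then have "injective_edge_coloring E (card E) f"
    using f unfolding injective_edge_coloring_def bij_betw_def by blast
  then show ?thesis by blast
qed

end

theory Submission
  imports Defs
begin

text \<open>
  Minimal counterexamples and discharging, on induced subgraphs. An edge \<open>uv\<close> conflicts with at most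
  \<open>2 (deg u - 1) + 2 (deg v - 1)\<close> edges. For 7 colours, deleting a vertex of degree at most 2 leaves edges
  with at most 6 conflicts. For 6 colours, no vertex has degree at most 1, no two vertices of degree 2
  are adjacent and no vertex of degree 3 has two neighbours of degree 2, so there are at least twice as
  many vertices of degree 3 as of degree 2. For 4 colours, each vertex of degree at most 2 is given pendant
  edges; then vertices of degree at most 1, triangles with two vertices of degree 2, paths of three
  vertices of degree 2, and vertices of degree 3 starting threads with at least 2, 2 and 1 vertices of
  degree 2 are all reducible, so there are at most twice as many vertices of degree 2 as of degree 3.
\<close>

section \<open>Colour lists\<close>

text \<open>For 7 and 6 colours, counting conflicts is enough. With 4 colours an edge may have 8
  conflicts, so counting is replaced by lists. A colouring is injective when, at every edge, the
  colours beyond one end are disjoint from those beyond the other. Each end carries at most two such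
  colours even after pendant edges are added, so an edge leaving the deleted part always finds at
  least two of the four colours still allowed. This is why the list lemmas assume only lists of size
  at least 2; they are pure statements about a four-element type. Vertices rather than edges are
  deleted because a conflict depends on its middle edge: that edge joins an end of one conflicting
  edge to an end of the other, so an induced subgraph keeps every conflict between edges that it
  keeps.\<close>

datatype colour = Red | Green | Blue | Yellow

lemma UNIV_colour: "UNIV = {Red, Green, Blue, Yellow}"
  using colour.exhaust by auto

instance colour :: finite
  by standard (simp add: UNIV_colour)

lemma CARD_colour: "card (UNIV :: colour set) = 4"
  by (simp add: UNIV_colour)

lemma ex_fresh: "\<exists>t::colour. t \<noteq> a \<and> t \<noteq> b \<and> t \<noteq> c"
proof -
  have "card {a, b, c} \<le> 3" by (simp add: card_insert_if)
  then have "{a, b, c} \<noteq> UNIV" using CARD_colour by auto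
  then show ?thesis by auto
qed

lemma four_colours:
  fixes a b c d :: colour
  assumes "distinct [a, b, c, d]"
  shows "x = a \<or> x = b \<or> x = c \<or> x = d"
proof -
  have "card {a, b, c, d} = 4" using assms by simp
  then have "{a, b, c, d} = UNIV" using CARD_colour by (intro card_seteq) auto
  then show ?thesis by auto
qed

lemma two_subsets:
  assumes "2 \<le> card S" "S \<subseteq> {p, q}" shows "S = {p, q}"
proof (rule card_seteq)
  have "card {p, q} \<le> 2" by (simp add: card_insert_if)
  then show "card {p, q} \<le> card S" using assms by linarith
qed (use assms in auto)

lemma ex_other:
  assumes "2 \<le> card S" shows "\<exists>s\<in>S. s \<noteq> a"
proof (rule ccontr)
  assume "\<not> ?thesis"
  then have "S \<subseteq> {a}" by auto
  from card_mono[OF _ this] assms show False by simp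
qed

text \<open>
  Colour lists for a path \<open>u\<close>, \<open>v\<close>, \<open>w\<close> of degree-2 vertices: \<open>\<mu>\<close>, \<open>\<nu>\<close> colour \<open>uv\<close>, \<open>vw\<close>, and \<open>\<pi>\<close>, \<open>\<tau>\<close>, \<open>\<rho>\<close>
  colour pendant edges at \<open>u\<close>, \<open>v\<close>, \<open>w\<close>; \<open>a\<close> and \<open>b\<close> are the colours of the edges leaving at \<open>u\<close> and \<open>w\<close>.
\<close>

lemma thread_lists:
  fixes a b :: colour
  assumes S: "2 \<le> card S" and T: "2 \<le> card T"
  shows "\<exists>\<mu>\<in>S. \<exists>\<pi>\<in>S. \<exists>\<nu>\<in>T. \<exists>\<rho>\<in>T. \<exists>\<tau>.
    \<nu> \<noteq> a \<and> \<nu> \<noteq> \<pi> \<and> \<tau> \<noteq> a \<and> \<tau> \<noteq> \<pi> \<and> \<mu> \<noteq> b \<and> \<mu> \<noteq> \<rho> \<and> \<tau> \<noteq> b \<and> \<tau> \<noteq> \<rho>" (is ?goal)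
proof -
  \<comment> \<open>\<tau> has to avoid \<open>a\<close>, \<open>b\<close>, \<pi> and \<rho>, which
    is possible as soon as two of these coincide. The lists therefore only have to supply the other
    four colours together with one coincidence.\<close>
  have I: ?goal if "\<mu> \<in> S" "\<pi> \<in> S" "\<nu> \<in> T" "\<rho> \<in> T" "\<nu> \<noteq> a" "\<nu> \<noteq> \<pi>" "\<mu> \<noteq> b" "\<mu> \<noteq> \<rho>"
    and "\<pi> = a \<or> \<pi> = b \<or> \<rho> = a \<or> \<rho> = b \<or> \<pi> = \<rho> \<or> a = b" for \<mu> \<pi> \<nu> \<rho>
  proof -
    have "\<exists>\<tau>. \<tau> \<noteq> a \<and> \<tau> \<noteq> \<pi> \<and> \<tau> \<noteq> b \<and> \<tau> \<noteq> \<rho>"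
      using that(9) ex_fresh[of a b \<rho>] ex_fresh[of a b \<pi>] ex_fresh[of a \<pi> \<rho>] by auto
    with that(1-8) show ?thesis by blast
  qed
  obtain \<mu> where \<mu>: "\<mu> \<in> S" "\<mu> \<noteq> b" using ex_other[OF S] by blast
  obtain \<nu> where \<nu>: "\<nu> \<in> T" "\<nu> \<noteq> a" using ex_other[OF T] by blast
  have oS: "\<exists>s\<in>S. x \<noteq> s" for x using ex_other[OF S, of x] by metis
  have oT: "\<exists>s\<in>T. x \<noteq> s" for x using ex_other[OF T, of x] by metis
  show ?thesis
  proof (cases "b \<in> S \<or> a \<in> T")
    case True
    show ?thesis
    proof (cases "S \<subseteq> {a, b} \<and> T \<subseteq> {a, b}")
      case True
      then have eq: "S = {a, b}" "T = {a, b}" using two_subsets[OF S] two_subsets[OF T] by simp_all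
      have "a \<noteq> b" using S eq(1) by auto
      then show ?thesis by (intro I[of a a b b]) (simp_all add: eq)
    next
      case False
      then consider \<nu>' where "b \<in> S" "\<nu>' \<in> T" "\<nu>' \<noteq> a" "\<nu>' \<noteq> b"
        | \<mu>' where "a \<in> T" "\<mu>' \<in> S" "\<mu>' \<noteq> a" "\<mu>' \<noteq> b"
      proof (cases "S \<subseteq> {a, b}")
        case True
        then have "b \<in> S" using \<open>b \<in> S \<or> a \<in> T\<close> False two_subsets[OF S True] by simp
        with True False that(1) show ?thesis by blast
      next
        case nS: False
        show ?thesis
        proof (cases "T \<subseteq> {a, b}")
          case True
          then have "a \<in> T" using two_subsets[OF T True] by simp
          with nS that(2) show ?thesis by blast
        next
          case False
          with nS \<open>b \<in> S \<or> a \<in> T\<close> that show ?thesis by blast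
        qed
      qed
      then show ?thesis
      proof cases
        case 1
        obtain \<rho> where "\<rho> \<in> T" "\<mu> \<noteq> \<rho>" using oT by blast
        with 1 \<mu> show ?thesis by (intro I[of \<mu> b \<nu>' \<rho>]) auto
      next
        case 2
        obtain \<pi> where "\<pi> \<in> S" "\<nu> \<noteq> \<pi>" using oS by blast
        with 2 \<nu> show ?thesis by (intro I[of \<mu>' \<pi> \<nu> a]) auto
      qed
    qed
  next
    case False
    obtain \<pi> where \<pi>: "\<pi> \<in> S" "\<nu> \<noteq> \<pi>" using oS by blast
    obtain \<rho> where \<rho>: "\<rho> \<in> T" "\<mu> \<noteq> \<rho>" using oT by blast
    \<comment> \<open>Taking \<pi> = \<open>a\<close> costs nothing, since \<nu> \<noteq>
      \<open>a\<close> is demanded anyway; likewise \<rho> = \<open>b\<close> and \<mu> \<noteq>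
      \<open>b\<close>.\<close>
    consider "a = b" | "a \<in> S" | "b \<in> T" | "a \<noteq> b" "a \<notin> S" "b \<notin> T" by blast
    then show ?thesis
    proof cases
      case 1
      with \<mu> \<nu> \<pi> \<rho> show ?thesis by (intro I[of \<mu> \<pi> \<nu> \<rho>]) auto
    next
      case 2
      with \<mu> \<nu> \<rho> show ?thesis by (intro I[of \<mu> a \<nu> \<rho>]) auto
    next
      case 3
      with \<mu> \<nu> \<pi> show ?thesis by (intro I[of \<mu> \<pi> \<nu> b]) auto
    next
      case 4
      \<comment> \<open>Both lists avoid \<open>a\<close> and \<open>b\<close>, so both consist of
        the same two remaining colours and \<pi> = \<rho> is available.\<close>
      obtain c where c: "c \<in> S" "\<mu> \<noteq> c" using oS by blast
      have "distinct [a, b, \<mu>, c]" using 4 c \<mu> False by auto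
      have "T \<subseteq> {\<mu>, c}"
      proof
        fix x assume "x \<in> T"
        with 4 False have "x \<noteq> a" "x \<noteq> b" by auto
        with four_colours[OF \<open>distinct [a, b, \<mu>, c]\<close>, of x] show "x \<in> {\<mu>, c}" by auto
      qed
      then have "T = {\<mu>, c}" using two_subsets[OF T] by blast
      then show ?thesis using c \<mu> False 4 by (intro I[of \<mu> c \<mu> c]) auto
    qed
  qed
qed

text \<open>
  Colour lists for a vertex \<open>v\<close> of degree 3 with neighbours \<open>x\<close>, \<open>y\<close>, \<open>z\<close> of degree 2, where the other
  neighbours \<open>x'\<close>, \<open>y'\<close> of \<open>x\<close>, \<open>y\<close> also have degree 2: \<open>\<alpha>\<close>, \<open>\<beta>\<close>, \<open>\<gamma>\<close>, \<open>\<mu>\<close> colour \<open>vx\<close>, \<open>vy\<close>, \<open>vz\<close>, \<open>xx'\<close>,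
  while \<open>\<pi>\<close>, \<open>\<rho>\<close>, \<open>\<zeta>\<close> colour pendant edges at \<open>x\<close>, \<open>x'\<close>, \<open>z\<close>. The colours \<open>a\<close>, \<open>b\<close>, \<open>c\<close> and the lists
  \<open>S\<close>, \<open>T\<close>, \<open>U\<close> come from the edges leaving \<open>x'\<close>, \<open>y'\<close>, \<open>z\<close>.
\<close>

definition side_colouring :: "colour set \<Rightarrow> colour \<Rightarrow> colour \<Rightarrow> colour \<Rightarrow> colour \<Rightarrow> bool" where
  "side_colouring S a \<alpha> \<beta> \<gamma> \<longleftrightarrow>
     (\<exists>\<mu>\<in>S. \<exists>\<rho>\<in>S. \<exists>\<pi>. \<mu> \<noteq> \<beta> \<and> \<mu> \<noteq> \<gamma> \<and> \<pi> \<noteq> a \<and> \<pi> \<noteq> \<beta> \<and> \<pi> \<noteq> \<gamma> \<and> \<rho> \<noteq> \<alpha> \<and> \<rho> \<noteq> \<pi>)"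

text \<open>Here \<open>a\<close>, \<beta>, \<gamma> take at most two values, so together with
  \<rho> they forbid at most three of the four colours to \<pi>.\<close>

lemma side_colouring_mem:
  assumes "2 \<le> card S" "\<not> S \<subseteq> {\<beta>, \<gamma>}" "a = \<beta> \<or> a = \<gamma> \<or> \<beta> = \<gamma>"
  shows "side_colouring S a \<alpha> \<beta> \<gamma>"
proof -
  obtain \<rho> where \<rho>: "\<rho> \<in> S" "\<rho> \<noteq> \<alpha>" using ex_other[OF assms(1)] by blast
  have "\<exists>\<pi>. \<pi> \<noteq> a \<and> \<pi> \<noteq> \<beta> \<and> \<pi> \<noteq> \<gamma> \<and> \<rho> \<noteq> \<pi>"
    using assms(3) ex_fresh[of \<beta> \<gamma> \<rho>] ex_fresh[of a \<beta> \<rho>] by auto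
  then show ?thesis using assms(2) \<rho> unfolding side_colouring_def by blast
qed

lemma side_colouring_same: "2 \<le> card S \<Longrightarrow> side_colouring S a \<alpha> \<beta> \<beta>"
  using ex_other[of S \<beta>] by (intro side_colouring_mem) auto

text \<open>Once \<pi> is fixed as \<open>d\<close>, the choices of \<mu> and \<rho> no longer
  affect each other: one has to leave {\<beta>, \<gamma>}, the other {\<alpha>,
  \<open>d\<close>}.\<close>

lemma side_colouring_gen:
  assumes "\<not> S \<subseteq> {\<beta>, \<gamma>}" "\<not> S \<subseteq> {\<alpha>, d}" "d \<noteq> a" "d \<noteq> \<beta>" "d \<noteq> \<gamma>"
  shows "side_colouring S a \<alpha> \<beta> \<gamma>"
  using assms unfolding side_colouring_def by blast

text \<open>The two long threads interact only through the colours at the centre: with \<alpha>,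
  \<beta>, \<gamma> fixed, each becomes a separate \<open>side_colouring\<close>, the second with
  \<alpha> and \<beta> exchanged. The conditions on \<zeta> and \<open>c\<close> belong to the edge
  from the centre to the third neighbour.\<close>

definition branch_colouring :: "colour \<Rightarrow> colour \<Rightarrow> colour \<Rightarrow> colour set \<Rightarrow> colour set \<Rightarrow> colour set \<Rightarrow> bool" where
  "branch_colouring a b c S T U \<longleftrightarrow> (\<exists>\<alpha> \<beta>. \<exists>\<gamma>\<in>U. \<exists>\<zeta>\<in>U. \<alpha> \<noteq> a \<and> \<alpha> \<noteq> c \<and> \<beta> \<noteq> b \<and> \<beta> \<noteq> c \<and>
     \<zeta> \<noteq> \<alpha> \<and> \<zeta> \<noteq> \<beta> \<and> side_colouring S a \<alpha> \<beta> \<gamma> \<and> side_colouring T b \<beta> \<alpha> \<gamma>)"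

lemma branch_colouringI:
  assumes "\<gamma> \<in> U" "\<zeta> \<in> U" "\<alpha> \<noteq> a" "\<alpha> \<noteq> c" "\<beta> \<noteq> b" "\<beta> \<noteq> c" "\<zeta> \<noteq> \<alpha>" "\<zeta> \<noteq> \<beta>"
    "side_colouring S a \<alpha> \<beta> \<gamma>" "side_colouring T b \<beta> \<alpha> \<gamma>"
  shows "branch_colouring a b c S T U"
  using assms unfolding branch_colouring_def by blast

lemma branch_colouring_sym: "branch_colouring b a c T S U \<Longrightarrow> branch_colouring a b c S T U"
  unfolding branch_colouring_def by blast

text \<open>Two devices carry the cases. Putting \<gamma> = \<beta> settles the side of
  \<open>S\<close> outright, and \<gamma> = \<alpha> the side of \<open>T\<close>. Letting
  \<open>a\<close> (for \<open>S\<close>) or \<open>b\<close> (for \<open>T\<close>) occur among the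
  two colours opposite that side makes \<open>side_colouring_mem\<close> applicable. Moreover a list
  of size at least two lies in at most one of {x, p} and {x, q}, so of two candidate colours one
  always works.\<close>

lemma branch_lists_aux:
  assumes S: "2 \<le> card S" and T: "2 \<le> card T" and U: "2 \<le> card U"
    and sub: "U \<subseteq> {a, b, c}" and a: "a \<in> U" "a \<noteq> c"
  shows "branch_colouring a b c S T U"
proof -
  have S1: "p = q" if "S \<subseteq> {x, p}" "S \<subseteq> {x, q}" for x p q
    using ex_other[OF S, of x] that by blast
  have T1: "p = q" if "T \<subseteq> {x, p}" "T \<subseteq> {x, q}" for x p q
    using ex_other[OF T, of x] that by blast
  note mem = side_colouring_mem[OF S] side_colouring_mem[OF T]
  note same = side_colouring_same[OF S] side_colouring_same[OF T]
  obtain u where u: "u \<in> U" "u \<noteq> a" using ex_other[OF U] by blast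
  consider "a = b" | "a \<noteq> b" "b = c" | "a \<noteq> b" "b \<noteq> c" by blast
  then show ?thesis
  proof cases
    case 1
    obtain d where d: "d \<noteq> a" "d \<noteq> c" using ex_fresh by blast
    obtain e where e: "e \<noteq> a" "e \<noteq> c" "e \<noteq> d" using ex_fresh by blast
    obtain \<beta> where \<beta>: "\<not> S \<subseteq> {a, \<beta>}" "\<beta> \<in> {d, e}" using S1[of a d e] e by blast
    obtain \<alpha> where \<alpha>: "\<not> T \<subseteq> {a, \<alpha>}" "\<alpha> \<in> {d, e}" using T1[of a d e] e by blast
    show ?thesis
      by (rule branch_colouringI[of a _ a \<alpha> _ _ \<beta>])
        (use a 1 \<alpha> \<beta> d e in \<open>auto intro!: mem simp: insert_commute\<close>)
  next
    case 2
    obtain d where d: "d \<noteq> a" "d \<noteq> b" using ex_fresh by blast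
    obtain e where e: "e \<noteq> a" "e \<noteq> b" "e \<noteq> d" using ex_fresh by blast
    have "U = {a, b}" using two_subsets[OF U] sub 2 by blast
    show ?thesis
    proof (cases "T \<subseteq> {d, a} \<or> T \<subseteq> {a, e}")
      case True
      have Tb: "\<not> T \<subseteq> {d, b}" "\<not> T \<subseteq> {e, b}"
        using two_subsets[OF T, of d a] two_subsets[OF T, of a e] True d e \<open>a \<noteq> b\<close> by blast+
      have Sd: "\<not> S \<subseteq> {x}" for x using ex_other[OF S, of x] by blast
      show ?thesis
      proof (cases "S \<subseteq> {e, b}")
        case True
        have "\<not> S \<subseteq> {d, b}" using S1[of b e d] True e by (auto simp: insert_commute)
        then have "side_colouring S a e d b"
          by (rule side_colouring_gen[where d = e]) (use d e Sd in auto)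
        moreover have "side_colouring T b d e b" using Tb by (intro mem) auto
        ultimately show ?thesis
          using a d e 2 \<open>U = {a, b}\<close> by (intro branch_colouringI[of b _ a e _ _ d]) auto
      next
        case False
        then have "side_colouring S a d e b"
          by (rule side_colouring_gen[where d = d]) (use d e Sd in auto)
        moreover have "side_colouring T b e d b" using Tb by (intro mem) auto
        ultimately show ?thesis
          using a d e 2 \<open>U = {a, b}\<close> by (intro branch_colouringI[of b _ a d _ _ e]) auto
      qed
    next
      case False
      then have "side_colouring T b a d a"
        by (intro side_colouring_gen[where d = e]) (use d e 2 in auto)
      then show ?thesis
        using a d e 2 \<open>U = {a, b}\<close> same by (intro branch_colouringI[of a _ b d _ _ a]) auto
    qed
  next
    case 3
    obtain e where e: "e \<noteq> a" "e \<noteq> b" "e \<noteq> c" using ex_fresh by blast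
    show ?thesis
    \<comment> \<open>The preferred choice is \<alpha> = \<open>e\<close>, \<beta> = \<gamma> =
      \<open>a\<close>, with \<open>c\<close> as the pendant colour on the side of \<open>T\<close>.
      It fails only for these two lists, and then \<open>T\<close> is not contained in
      {\<open>a\<close>, \<open>b\<close>}, which the remaining choices exploit.\<close>
    proof (cases "T \<subseteq> {e, a} \<or> T \<subseteq> {a, c}")
      case False
      then have "side_colouring T b a e a"
        by (intro side_colouring_gen[where d = c]) (use e 3 a in auto)
      then show ?thesis
        using a e 3 u sub same by (intro branch_colouringI[of a _ u e _ _ a]) auto
    next
      case True
      then have Tb: "\<not> T \<subseteq> {b, a}"
        using T1[of a b e] T1[of a b c] e 3 by (auto simp: insert_commute)
      show ?thesis
      proof (cases "b \<in> U")
        case False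
        then have "c \<in> U" using u sub by blast
        moreover have "side_colouring T b a b a" using Tb by (intro mem) auto
        ultimately show ?thesis
          using a e 3 same by (intro branch_colouringI[of a _ c b _ _ a]) auto
      next
        case b: True
        show ?thesis
        proof (cases "S \<subseteq> {e, a}")
          case False
          then have "side_colouring S a b e a" by (intro mem) auto
          moreover have "side_colouring T b e b a" using Tb by (intro mem) auto
          ultimately show ?thesis
            using a e 3 by (intro branch_colouringI[of a _ a b _ _ e]) auto
        next
          case True
          then have "\<not> S \<subseteq> {e, b}" "\<not> S \<subseteq> {b, c}"
            using two_subsets[OF S, of e a] e a 3 by blast+
          then have "side_colouring S a b e b"
            by (intro side_colouring_gen[where d = c]) (use e a 3 in auto)
          then show ?thesis
            using a b e 3 same by (intro branch_colouringI[of b _ a b _ _ e]) auto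
        qed
      qed
    qed
  qed
qed

text \<open>A colour of \<open>U\<close> outside {\<open>a\<close>, \<open>b\<close>,
  \<open>c\<close>} can be used on all three edges at the centre. Otherwise some colour of
  \<open>U\<close> differs from \<open>c\<close>, hence is \<open>a\<close> or \<open>b\<close>, and
  the two sides are interchangeable.\<close>

lemma branch_lists:
  assumes S: "2 \<le> card S" and T: "2 \<le> card T" and U: "2 \<le> card U"
  shows "branch_colouring a b c S T U"
proof (cases "U \<subseteq> {a, b, c}")
  case False
  then obtain t where t: "t \<in> U" "t \<noteq> a" "t \<noteq> b" "t \<noteq> c" by blast
  obtain u where "u \<in> U" "u \<noteq> t" using ex_other[OF U] by blast
  with t show ?thesis
    by (intro branch_colouringI[of t _ u t _ _ t]) (auto intro: side_colouring_same S T)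
next
  case True
  obtain u where "u \<in> U" "u \<noteq> c" using ex_other[OF U] by blast
  with True consider "a \<in> U" "a \<noteq> c" | "b \<in> U" "b \<noteq> c" by blast
  then show ?thesis
  proof cases
    case 1
    then show ?thesis using branch_lists_aux[OF S T U True] by blast
  next
    case 2
    have "U \<subseteq> {b, a, c}" using True by blast
    from branch_lists_aux[OF T S U this] 2 show ?thesis by (blast intro: branch_colouring_sym)
  qed
qed

lemma card_Compl_colour: "card (- S :: colour set) = 4 - card S"
  using CARD_colour by (simp add: Compl_eq_Diff_UNIV card_Diff_subset)

text \<open>For a triangle v, x, y with x and y of degree 2: \<alpha>, \<beta>, \<gamma> colour vx,
  vy, xy, the colours \<delta>, \<epsilon> are those of the pendant edges at x and y, and
  \<open>g\<close> is the remaining colour at v.\<close>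

lemma triangle_colours:
  fixes g \<alpha> \<beta> :: colour
  assumes "\<alpha> \<noteq> \<beta>"
  shows "\<exists>\<gamma> \<delta> \<epsilon>. \<gamma> \<noteq> g \<and> \<gamma> \<noteq> \<alpha> \<and> \<gamma> \<noteq> \<beta> \<and> \<delta> \<noteq> g \<and> \<delta> \<noteq> \<beta> \<and> \<epsilon> \<noteq> g \<and> \<epsilon> \<noteq> \<alpha> \<and> \<delta> \<noteq> \<epsilon>"
proof -
  obtain \<gamma> where \<gamma>: "\<gamma> \<noteq> g" "\<gamma> \<noteq> \<alpha>" "\<gamma> \<noteq> \<beta>" using ex_fresh by blast
  consider "g \<noteq> \<alpha>" "g \<noteq> \<beta>" | "g = \<alpha>" | "g = \<beta>" by blast
  then show ?thesis
  proof cases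
    case 1
    with \<gamma> assms show ?thesis by (intro exI[of _ \<gamma>] exI[of _ \<alpha>] exI[of _ \<beta>]) auto
  next
    case 2
    with \<gamma> assms show ?thesis by (intro exI[of _ \<gamma>] exI[of _ \<gamma>] exI[of _ \<beta>]) auto
  next
    case 3
    with \<gamma> assms show ?thesis by (intro exI[of _ \<gamma>] exI[of _ \<alpha>] exI[of _ \<gamma>]) auto
  qed
qed

section \<open>Conflicting edges and greedy colouring\<close>

lemma least_inj_chromatic_index: "injective_edge_coloring E k col \<Longrightarrow> inj_chromatic_index E \<le> k"
  unfolding inj_chromatic_index_def by (rule Least_le) blast

definition conflicts :: "'a set set \<Rightarrow> 'a set \<Rightarrow> 'a set set" where
  "conflicts G e = {f. \<exists>g. consecutive G e g f}"

lemma consecutive_sym: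
  assumes "consecutive G e g f" shows "consecutive G f g e"
proof -
  have "(\<exists>a b c d. distinct [a, b, c, d] \<and> e = {a, b} \<and> g = {b, c} \<and> f = {c, d}) \<or>
      (\<exists>a b c. distinct [a, b, c] \<and> e = {a, b} \<and> g = {b, c} \<and> f = {c, a})"
    using assms by (simp add: consecutive_def)
  then have "(\<exists>a b c d. distinct [a, b, c, d] \<and> f = {a, b} \<and> g = {b, c} \<and> e = {c, d}) \<or>
      (\<exists>a b c. distinct [a, b, c] \<and> f = {a, b} \<and> g = {b, c} \<and> e = {c, a})"
  proof (elim disjE exE conjE)
    fix a b c d assume "distinct [a, b, c, d]" "e = {a, b}" "g = {b, c}" "f = {c, d}"
    then have "distinct [d, c, b, a] \<and> f = {d, c} \<and> g = {c, b} \<and> e = {b, a}" by auto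
    then show ?thesis by blast
  next
    fix a b c assume "distinct [a, b, c]" "e = {a, b}" "g = {b, c}" "f = {c, a}"
    then have "distinct [a, c, b] \<and> f = {a, c} \<and> g = {c, b} \<and> e = {b, a}" by auto
    then show ?thesis by blast
  qed
  then show ?thesis using assms by (simp add: consecutive_def)
qed

lemma conflicts_sym: "f \<in> conflicts G e \<Longrightarrow> e \<in> conflicts G f"
  unfolding conflicts_def using consecutive_sym by blast

lemma conflicts_irrefl: "e \<notin> conflicts G e"
  by (auto simp: conflicts_def consecutive_def doubleton_eq_iff)

lemma conflicts_subset: "conflicts G e \<subseteq> G"
  by (auto simp: conflicts_def consecutive_def)

lemma finite_conflicts: "finite G \<Longrightarrow> finite (conflicts G e)"
  by (rule finite_subset[OF conflicts_subset])

text \<open>The middle edge \<open>g\<close> lies in \<open>e \<union> f\<close>, so it is present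
  in any induced subgraph containing both edges.\<close>

lemma conflicts_mono_vertices:
  assumes "f \<in> conflicts {e \<in> E. e \<subseteq> W} e" "e \<subseteq> U" "f \<subseteq> U"
  shows "f \<in> conflicts {e \<in> E. e \<subseteq> U} e"
proof -
  obtain g where g: "consecutive {e \<in> E. e \<subseteq> W} e g f"
    using assms(1) by (auto simp: conflicts_def)
  then have "g \<subseteq> e \<union> f" by (auto simp: consecutive_def)
  with g assms(2,3) have "consecutive {e \<in> E. e \<subseteq> U} e g f" by (auto simp: consecutive_def)
  then show ?thesis by (auto simp: conflicts_def)
qed

text \<open>Conflicts are taken in \<open>G\<close> although only \<open>F\<close> is coloured.
  Edges can thus be restored one at a time while every conflict bound refers to the final
  graph.\<close>

definition part_colourable :: "nat \<Rightarrow> 'a set set \<Rightarrow> 'a set set \<Rightarrow> bool" where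
  "part_colourable k G F \<longleftrightarrow> (\<exists>col. col \<in> F \<rightarrow> {1..k} \<and> (\<forall>e\<in>F. \<forall>f\<in>F. f \<in> conflicts G e \<longrightarrow> col e \<noteq> col f))"

lemma part_colourable_all:
  assumes "part_colourable k E E" shows "inj_chromatic_index E \<le> k"
proof -
  obtain col where col: "col \<in> E \<rightarrow> {1..k}" "\<And>e f. e \<in> E \<Longrightarrow> f \<in> E \<Longrightarrow> f \<in> conflicts E e \<Longrightarrow> col e \<noteq> col f"
    using assms unfolding part_colourable_def by blast
  have "col e \<noteq> col f" if "consecutive E e g f" for e g f
  proof (rule col(2))
    show "e \<in> E" "f \<in> E" using that by (simp_all add: consecutive_def)
    show "f \<in> conflicts E e" using that by (auto simp: conflicts_def)
  qed
  with col(1) have "injective_edge_coloring E k col"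
    unfolding injective_edge_coloring_def by blast
  then show ?thesis by (rule least_inj_chromatic_index)
qed

lemma part_colourable_subset: "part_colourable k G F \<Longrightarrow> F' \<subseteq> F \<Longrightarrow> part_colourable k G F'"
  unfolding part_colourable_def by blast

lemma part_colourable_insert:
  assumes F: "part_colourable k G F" and "finite G" and less: "card (conflicts G e \<inter> F) < k"
  shows "part_colourable k G (insert e F)"
proof (cases "e \<in> F")
  case True
  with F show ?thesis by (simp add: insert_absorb)
next
  case False
  obtain col where col: "col \<in> F \<rightarrow> {1..k}" "\<And>e f. e \<in> F \<Longrightarrow> f \<in> F \<Longrightarrow> f \<in> conflicts G e \<Longrightarrow> col e \<noteq> col f"
    using F unfolding part_colourable_def by blast
  have "finite (conflicts G e \<inter> F)" using finite_conflicts[OF \<open>finite G\<close>] by simp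
  then have fin: "finite (col ` (conflicts G e \<inter> F))" and "card (col ` (conflicts G e \<inter> F)) < k"
    using card_image_le[of "conflicts G e \<inter> F" col] less by auto
  then have "\<not> {1..k} \<subseteq> col ` (conflicts G e \<inter> F)"
    using card_mono[OF fin, of "{1..k}"] by auto
  then obtain j where j: "j \<in> {1..k}" "j \<notin> col ` (conflicts G e \<inter> F)" by blast
  have "(col(e := j)) e1 \<noteq> (col(e := j)) e2"
    if "e1 \<in> insert e F" "e2 \<in> insert e F" "e2 \<in> conflicts G e1" for e1 e2
    using that j(2) col(2)[of e1 e2] conflicts_irrefl[of e G] conflicts_sym[of e2 G e1] False by auto
  moreover have "col(e := j) \<in> insert e F \<rightarrow> {1..k}" using col(1) j(1) by auto
  ultimately show ?thesis unfolding part_colourable_def by blast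
qed

lemma part_colourable_Un:
  assumes "finite S" "part_colourable k G F" "finite G" "\<And>e. e \<in> S \<Longrightarrow> card (conflicts G e) < k"
  shows "part_colourable k G (F \<union> S)"
  using assms(1,4)
proof (induction S)
  case empty
  then show ?case using assms(2) by simp
next
  case (insert e S)
  have "card (conflicts G e \<inter> (F \<union> S)) \<le> card (conflicts G e)"
    using finite_conflicts[OF \<open>finite G\<close>] by (intro card_mono) auto
  also have "\<dots> < k" using insert.prems by simp
  finally have "part_colourable k G (insert e (F \<union> S))"
    using insert by (intro part_colourable_insert \<open>finite G\<close>) auto
  then show ?case by simp
qed

lemma part_colourable_induced:
  assumes "part_colourable k {e \<in> E. e \<subseteq> U} {e \<in> E. e \<subseteq> U}"
  shows "part_colourable k {e \<in> E. e \<subseteq> W} {e \<in> E. e \<subseteq> U}"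
  using assms unfolding part_colourable_def by (blast intro: conflicts_mono_vertices)

section \<open>Degrees and edge counts in induced subgraphs of a subcubic graph\<close>

locale subcubic_graph =
  fixes V :: "'a set" and E :: "'a set set"
  assumes simple: "simple_graph V E" and cubic: "subcubic V E"
begin

definition ind :: "'a set \<Rightarrow> 'a set set" where "ind W = {e \<in> E. e \<subseteq> W}"

definition nb :: "'a set \<Rightarrow> 'a \<Rightarrow> 'a set" where "nb W v = {w \<in> W. {v, w} \<in> E}"

abbreviation dg :: "'a set \<Rightarrow> 'a \<Rightarrow> nat" where "dg W v \<equiv> card (nb W v)"

lemma finite_V: "finite V" and finite_E: "finite E"
  using simple simple_graph_finite_edges by (auto simp: simple_graph_def)

lemma finite_ind: "finite (ind W)"
  using finite_E by (simp add: ind_def)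

lemma card_edge: "e \<in> E \<Longrightarrow> card e = 2"
  using simple by (auto simp: simple_graph_def)

lemma edgeE:
  assumes "e \<in> E" obtains u v where "e = {u, v}" "u \<noteq> v"
  using card_edge[OF assms] by (auto simp: card_2_iff)

lemma nb_sym: "v \<in> W \<Longrightarrow> u \<in> nb W v \<Longrightarrow> v \<in> nb W u"
  by (auto simp: nb_def insert_commute)

lemma nb_irrefl: "v \<notin> nb W v"
  using card_edge[of "{v}"] by (auto simp: nb_def)

lemma nb_subset: "nb W v \<subseteq> W"
  by (auto simp: nb_def)

lemma finite_nb: "W \<subseteq> V \<Longrightarrow> finite (nb W v)"
  using finite_V finite_subset[of "nb W v" V] nb_subset by blast

lemma incident_ind: "v \<in> W \<Longrightarrow> {e \<in> ind W. v \<in> e} = (\<lambda>u. {v, u}) ` nb W v"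
proof (intro equalityI subsetI)
  fix e assume "v \<in> W" "e \<in> {e \<in> ind W. v \<in> e}"
  then have e: "e \<in> E" "e \<subseteq> W" "v \<in> e" by (auto simp: ind_def)
  obtain a b where "e = {a, b}" "a \<noteq> b" using e(1) by (rule edgeE)
  with e(3) obtain u where "e = {v, u}" by (auto simp: insert_commute)
  with e show "e \<in> (\<lambda>u. {v, u}) ` nb W v" by (auto simp: nb_def)
qed (auto simp: ind_def nb_def)

lemma inj_pair: "inj_on (\<lambda>u. {v, u}) A"
  by (auto simp: inj_on_def doubleton_eq_iff)

lemma dg_eq_incident: "v \<in> W \<Longrightarrow> dg W v = card {e \<in> ind W. v \<in> e}"
  by (simp add: incident_ind card_image inj_pair)

lemma dg_le_3:
  assumes "W \<subseteq> V" "v \<in> W" shows "dg W v \<le> 3"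
proof -
  have "dg W v \<le> degree E v"
    unfolding dg_eq_incident[OF assms(2)] degree_def
    by (rule card_mono) (use finite_E in \<open>auto simp: ind_def\<close>)
  also have "\<dots> \<le> max_degree V E"
    unfolding max_degree_def using finite_V assms by (intro Max_ge) auto
  also have "\<dots> \<le> 3" using cubic by (simp add: subcubic_def)
  finally show ?thesis .
qed

lemma handshake:
  assumes "W \<subseteq> V" shows "(\<Sum>v\<in>W. dg W v) = 2 * card (ind W)"
proof -
  have fW: "finite W" using assms finite_V finite_subset by blast
  have "(\<Sum>v\<in>W. dg W v) = (\<Sum>v\<in>W. card {e \<in> ind W. v \<in> e})"
    by (simp add: dg_eq_incident)
  also have "\<dots> = 2 * card (ind W)"
  proof (rule sum_multicount[OF fW finite_ind], intro ballI)
    fix e assume e: "e \<in> ind W"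
    then have "{v \<in> W. v \<in> e} = e" by (auto simp: ind_def)
    with e show "card {v \<in> W. v \<in> e} = 2" using card_edge by (simp add: ind_def)
  qed
  finally show ?thesis .
qed

lemma count_deg23:
  assumes W: "W \<subseteq> V" and deg: "\<And>v. v \<in> W \<Longrightarrow> dg W v = 2 \<or> dg W v = 3"
  defines "A \<equiv> {v \<in> W. dg W v = 2}" and "B \<equiv> {v \<in> W. dg W v = 3}"
  shows "card W = card A + card B" "2 * card (ind W) = 2 * card A + 3 * card B"
proof -
  have fin: "finite A" "finite B" using finite_subset[OF W finite_V] by (simp_all add: A_def B_def)
  have AB: "A \<union> B = W" "A \<inter> B = {}" using deg by (auto simp: A_def B_def)
  show "card W = card A + card B" using card_Un_disjoint[OF fin AB(2)] AB(1) by simp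
  have "(\<Sum>v\<in>W. dg W v) = (\<Sum>v\<in>A. dg W v) + (\<Sum>v\<in>B. dg W v)"
    using sum.union_disjoint[OF fin AB(2), of "dg W"] AB(1) by simp
  then show "2 * card (ind W) = 2 * card A + 3 * card B"
    using handshake[OF W] by (simp add: A_def B_def)
qed

lemma mad_bound:
  assumes "W \<subseteq> V" "W \<noteq> {}"
  shows "2 * real (card (ind W)) \<le> mad V E * real (card W)"
proof -
  have "subgraph W (ind W) V E"
    using assms finite_V finite_subset card_edge
    by (auto simp: subgraph_def simple_graph_def ind_def)
  then have "2 * real (card (ind W)) / real (card W) \<le> mad V E"
    unfolding mad_def using finite_mad_values[OF simple] assms by (intro Max_ge) auto
  moreover have "0 < card W" using assms finite_V finite_subset by (auto simp: card_gt_0_iff)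
  ultimately show ?thesis by (simp add: divide_le_eq)
qed

text \<open>Bookkeeping for discharging: the total charge received by \<open>A\<close> equals the
  total charge sent by \<open>B\<close>.\<close>

lemma double_count:
  assumes "W \<subseteq> V" "A \<subseteq> W" "B \<subseteq> W"
  shows "(\<Sum>u\<in>A. \<Sum>v\<in>nb W u \<inter> B. f u v) = (\<Sum>v\<in>B. \<Sum>u\<in>nb W v \<inter> A. f u v)"
proof -
  have fin: "finite A" "finite B" using assms finite_V finite_subset by metis+
  have "nb W u \<inter> B = {v. v \<in> B \<and> {u, v} \<in> E}" for u using assms by (auto simp: nb_def)
  moreover have "nb W v \<inter> A = {u. u \<in> A \<and> {u, v} \<in> E}" for v
    using assms by (auto simp: nb_def insert_commute)
  ultimately show ?thesis using sum.swap_restrict[OF fin, of f "\<lambda>u v. {u, v} \<in> E"] by simp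
qed

section \<open>Counting the conflicts of an edge\<close>

lemma conflictsE:
  assumes "f \<in> conflicts (ind W) e"
  obtains a b c d where "e = {a, b}" "f = {c, d}" "c \<in> nb W b" "a \<noteq> c" "d \<noteq> b"
proof -
  obtain g where cons: "consecutive (ind W) e g f" using assms by (auto simp: conflicts_def)
  then have "g \<in> ind W" by (simp add: consecutive_def)
  then have nb: "c \<in> nb W b" if "g = {b, c}" for b c
    using that by (simp add: ind_def nb_def)
  from cons show ?thesis
    unfolding consecutive_def
  proof (elim conjE disjE exE)
    fix a b c d assume *: "e = {a, b}" "g = {b, c}" "f = {c, d}" "distinct [a, b, c, d]"
    have "a \<noteq> c" "d \<noteq> b" using *(4) by auto
    then show ?thesis by (rule that[OF *(1,3) nb[OF *(2)]])
  next
    fix a b c assume *: "e = {a, b}" "g = {b, c}" "f = {c, a}" "distinct [a, b, c]"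
    have "a \<noteq> c" "a \<noteq> b" using *(4) by auto
    then show ?thesis by (rule that[OF *(1,3) nb[OF *(2)]])
  qed
qed

lemma nb_if_ind: "{u, v} \<in> ind W \<Longrightarrow> v \<in> nb W u" "{u, v} \<in> ind W \<Longrightarrow> u \<in> nb W v"
  by (simp_all add: ind_def nb_def insert_commute)

text \<open>The possible conflicts of the edge \<open>uv\<close> on the side of \<open>u\<close>.
  The far end \<open>y\<close> may be \<open>v\<close> itself, which accounts for triangles.\<close>

definition reach :: "'a set \<Rightarrow> 'a \<Rightarrow> 'a \<Rightarrow> 'a set set" where
  "reach W u v = (\<Union>x\<in>nb W u - {v}. (\<lambda>y. {x, y}) ` (nb W x - {u}))"

lemma conflicts_subset_reach: "conflicts (ind W) {v, u} \<subseteq> reach W u v \<union> reach W v u"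
proof
  fix f assume f: "f \<in> conflicts (ind W) {v, u}"
  then obtain a b c d where *: "{v, u} = {a, b}" "f = {c, d}" "c \<in> nb W b" "a \<noteq> c" "d \<noteq> b"
    by (rule conflictsE)
  have "{c, d} \<in> ind W" using f *(2) conflicts_subset by blast
  then have "c \<in> nb W b - {a}" "d \<in> nb W c - {b}" using * nb_if_ind(1) by auto
  then have "f \<in> reach W b a" unfolding reach_def \<open>f = {c, d}\<close> by blast
  moreover have "a = v \<and> b = u \<or> a = u \<and> b = v"
    using *(1) doubleton_eq_iff[of v u a b] by metis
  ultimately show "f \<in> reach W u v \<union> reach W v u" by (elim disjE) simp_all
qed

lemma finite_reach: "W \<subseteq> V \<Longrightarrow> finite (reach W u v)"
  unfolding reach_def using finite_nb by blast

lemma card_reach_sum: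
  assumes "W \<subseteq> V" "u \<in> W"
  shows "card (reach W u v) \<le> (\<Sum>x\<in>nb W u - {v}. dg W x - 1)"
proof -
  have "card (reach W u v) \<le> (\<Sum>x\<in>nb W u - {v}. card ((\<lambda>y. {x, y}) ` (nb W x - {u})))"
    unfolding reach_def using finite_nb[OF assms(1)] by (intro card_UN_le) auto
  also have "\<dots> = (\<Sum>x\<in>nb W u - {v}. dg W x - 1)"
    using nb_sym[OF assms(2)] by (intro sum.cong) (auto simp: card_image inj_pair)
  finally show ?thesis .
qed

lemma card_reach:
  assumes "W \<subseteq> V" "u \<in> W" "v \<in> nb W u"
  shows "card (reach W u v) \<le> 2 * (dg W u - 1)"
proof -
  have "dg W x - 1 \<le> 2" if "x \<in> nb W u" for x
    using dg_le_3[OF assms(1), of x] that nb_subset by fastforce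
  then have "(\<Sum>x\<in>nb W u - {v}. dg W x - 1) \<le> (\<Sum>x\<in>nb W u - {v}. 2)" by (intro sum_mono) auto
  also have "\<dots> = 2 * (dg W u - 1)" using assms(3) by (simp add: mult.commute)
  finally show ?thesis using card_reach_sum[OF assms(1,2), of v] by linarith
qed

lemma card_reach_le_4:
  "W \<subseteq> V \<Longrightarrow> u \<in> W \<Longrightarrow> v \<in> nb W u \<Longrightarrow> card (reach W u v) \<le> 4"
  using card_reach[of W u v] dg_le_3[of W u] by linarith

text \<open>The neighbour \<open>w\<close> contributes one edge instead of the two allowed for in
  \<open>card_reach\<close>.\<close>

lemma card_reach_deg2:
  assumes "W \<subseteq> V" "u \<in> W" "v \<in> nb W u" "w \<in> nb W u" "w \<noteq> v" "dg W w = 2"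
  shows "card (reach W u v) + 1 \<le> 2 * (dg W u - 1)"
proof -
  have fin: "finite (nb W u)" using finite_nb assms(1) by blast
  have le: "dg W x - 1 \<le> 2" if "x \<in> nb W u" for x
    using dg_le_3[OF assms(1), of x] that nb_subset by fastforce
  have "(\<Sum>x\<in>nb W u - {v}. dg W x - 1) = (dg W w - 1) + (\<Sum>x\<in>nb W u - {v} - {w}. dg W x - 1)"
    using assms fin by (intro sum.remove) auto
  also have "\<dots> \<le> 1 + (\<Sum>x\<in>nb W u - {v} - {w}. 2)"
    using assms le by (intro add_mono sum_mono) auto
  also have "\<dots> = 1 + 2 * (dg W u - 2)" using assms fin by (simp add: mult.commute)
  finally have "card (reach W u v) \<le> 1 + 2 * (dg W u - 2)"
    using card_reach_sum[OF assms(1,2), of v] by linarith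
  \<comment> \<open>This makes the degree at least 2, so the truncated subtraction
    \<open>dg W u - 2\<close> is a true one.\<close>
  moreover have "card {v, w} \<le> dg W u" using assms fin by (intro card_mono) auto
  ultimately show ?thesis using \<open>w \<noteq> v\<close> by simp
qed

lemma card_conflicts:
  assumes "W \<subseteq> V" "v \<in> W" "u \<in> nb W v"
  shows "card (conflicts (ind W) {v, u}) \<le> card (reach W u v) + card (reach W v u)"
proof -
  have "card (conflicts (ind W) {v, u}) \<le> card (reach W u v \<union> reach W v u)"
    using finite_reach[OF assms(1)] by (intro card_mono conflicts_subset_reach) auto
  also have "\<dots> \<le> card (reach W u v) + card (reach W v u)" by (rule card_Un_le)
  finally show ?thesis .
qed

section \<open>Greedy extension after vertex deletion: seven and six colours\<close>

lemma ind_remove: "v \<in> W \<Longrightarrow> ind W = ind (W - {v}) \<union> (\<lambda>u. {v, u}) ` nb W v"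
proof -
  assume "v \<in> W"
  have "ind W = ind (W - {v}) \<union> {e \<in> ind W. v \<in> e}" by (auto simp: ind_def)
  then show ?thesis using incident_ind[OF \<open>v \<in> W\<close>] by simp
qed

text \<open>The bound counts all conflicts of a restored edge in \<open>ind W\<close>, including
  those with other restored edges, so the order of restoring is irrelevant.\<close>

lemma delete_vertex:
  assumes "W \<subseteq> V" "v \<in> W" and "part_colourable k (ind (W - {v})) (ind (W - {v}))"
    and "\<And>u. u \<in> nb W v \<Longrightarrow> card (reach W u v) + card (reach W v u) < k"
  shows "part_colourable k (ind W) (ind W)"
proof -
  have "part_colourable k (ind W) (ind (W - {v}))"
    using assms(3) part_colourable_induced unfolding ind_def by blast
  then have "part_colourable k (ind W) (ind (W - {v}) \<union> (\<lambda>u. {v, u}) ` nb W v)"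
    using finite_nb[OF assms(1)] finite_ind le_less_trans[OF card_conflicts[OF assms(1,2)] assms(4)]
    by (intro part_colourable_Un) auto
  then show ?thesis using ind_remove[OF assms(2)] by simp
qed

lemma seven_colours:
  assumes sparse: "\<And>W. W \<subseteq> V \<Longrightarrow> W \<noteq> {} \<Longrightarrow> 2 * card (ind W) < 3 * card W" and "W \<subseteq> V"
  shows "part_colourable 7 (ind W) (ind W)"
  using finite_subset[OF assms(2) finite_V] assms(2)
proof (induction W rule: finite_psubset_induct)
  case (psubset W)
  show ?case
  proof (cases "W = {}")
    case True
    then have "ind W = {}" using card_edge[of "{}"] by (auto simp: ind_def)
    then show ?thesis by (simp add: part_colourable_def)
  next
    case False
    have "\<not> (\<forall>v\<in>W. 3 \<le> dg W v)"
    proof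
      assume "\<forall>v\<in>W. 3 \<le> dg W v"
      then have "(\<Sum>v\<in>W. 3) \<le> (\<Sum>v\<in>W. dg W v)" by (intro sum_mono) auto
      then show False using handshake[OF psubset.prems] sparse[OF psubset.prems False] by simp
    qed
    then obtain v where v: "v \<in> W" "dg W v \<le> 2" by force
    show ?thesis
    proof (rule delete_vertex[OF psubset.prems v(1)])
      show "part_colourable 7 (ind (W - {v})) (ind (W - {v}))"
        using psubset v by blast
      fix u assume u: "u \<in> nb W v"
      have "card (reach W v u) \<le> 2" using card_reach[OF psubset.prems v(1) u] v by linarith
      moreover have "card (reach W u v) \<le> 4"
        using u nb_subset nb_sym[OF v(1) u] by (intro card_reach_le_4 psubset.prems) auto
      ultimately show "card (reach W u v) + card (reach W v u) < 7" by linarith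
    qed
  qed
qed

text \<open>The edge \<open>vw\<close> has at most 2 + 2 conflicts. Any other edge at
  \<open>v\<close> has at most 4 beyond its far end and only one beyond \<open>v\<close>, namely the
  second edge at \<open>w\<close>.\<close>

lemma delete_adjacent_deg2:
  assumes "W \<subseteq> V" "v \<in> W" "dg W v \<le> 2" "w \<in> nb W v" "dg W w = 2"
    and "part_colourable 6 (ind (W - {v})) (ind (W - {v}))"
  shows "part_colourable 6 (ind W) (ind W)"
proof (rule delete_vertex[OF assms(1,2,6)])
  fix u assume u: "u \<in> nb W v"
  have uW: "u \<in> W" "v \<in> nb W u" using nb_subset u nb_sym[OF assms(2) u] by auto
  show "card (reach W u v) + card (reach W v u) < 6"
  proof (cases "u = w")
    case True
    then show ?thesis
      using card_reach[OF assms(1) uW] card_reach[OF assms(1,2) u] assms(3,5) by simp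
  next
    case False
    then have "card (reach W v u) + 1 \<le> 2 * (dg W v - 1)"
      using card_reach_deg2[OF assms(1,2) u assms(4)] assms(5) by simp
    then show ?thesis
      using card_reach_le_4[OF assms(1) uW] assms(3) by linarith
  qed
qed

text \<open>Deleting \<open>u\<close> alone is not enough: its other edge \<open>wu\<close> may have
  4 conflicts beyond \<open>w\<close> and 2 at \<open>v\<close>. Uncolouring \<open>vu'\<close> as
  well removes one of the latter, so \<open>wu\<close> can be coloured while seeing at most 5
  colours. Afterwards \<open>vu\<close> and \<open>vu'\<close> fit in any order, each having at most
  3 conflicts beyond \<open>v\<close> and 2 beyond its end of degree 2.\<close>

lemma delete_two_deg2:
  assumes W: "W \<subseteq> V" "v \<in> W" and u: "u \<in> nb W v" "u' \<in> nb W v" "u \<noteq> u'" "dg W u = 2" "dg W u' = 2"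
    and col: "part_colourable 6 (ind (W - {u})) (ind (W - {u}))"
  shows "part_colourable 6 (ind W) (ind W)"
proof -
  have uW: "u \<in> W" "v \<in> nb W u" "u' \<in> W" "v \<in> nb W u'"
    using nb_subset u nb_sym[OF W(2)] by auto
  have fin: "finite (nb W v)" using finite_nb[OF W(1)] .
  have "card (nb W u - {v}) = 1" using uW u by simp
  then obtain w where "nb W u - {v} = {w}" by (auto simp: card_1_singleton_iff)
  then have w: "nb W u = {v, w}" "w \<noteq> v" using uW by auto
  have wW: "w \<in> W" "u \<in> nb W w" using w nb_subset[of W u] nb_sym[OF uW(1), of w] by auto
  define F where "F = ind (W - {u}) - {{v, u'}}"
  have "part_colourable 6 (ind W) (ind (W - {u}))"
    using part_colourable_induced col unfolding ind_def by blast
  then have "part_colourable 6 (ind W) F"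
    by (rule part_colourable_subset) (auto simp: F_def)
  then have "part_colourable 6 (ind W) (insert {w, u} F)"
  proof (rule part_colourable_insert[OF _ finite_ind])
    have "reach W u w = (\<lambda>y. {v, y}) ` (nb W v - {u})"
      using w by (auto simp: reach_def)
    then have "reach W u w \<inter> F \<subseteq> (\<lambda>y. {v, y}) ` (nb W v - {u, u'})"
      by (auto simp: F_def)
    then have "card (reach W u w \<inter> F) \<le> card ((\<lambda>y. {v, y}) ` (nb W v - {u, u'}))"
      using fin by (intro card_mono) auto
    also have "\<dots> \<le> card (nb W v - {u, u'})" using fin by (intro card_image_le) auto
    also have "\<dots> = dg W v - card {u, u'}" using u by (intro card_Diff_subset) auto
    also have "\<dots> \<le> 1" using dg_le_3[OF W] u by simp
    finally have "card (reach W u w \<inter> F) \<le> 1" .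
    moreover have "card (reach W w u) \<le> 4" using card_reach_le_4[OF W(1) wW] .
    moreover have "card (conflicts (ind W) {w, u} \<inter> F) \<le> card ((reach W u w \<inter> F) \<union> reach W w u)"
      using conflicts_subset_reach[of W w u] finite_reach[OF W(1)] by (intro card_mono) auto
    ultimately show "card (conflicts (ind W) {w, u} \<inter> F) < 6"
      using card_Un_le[of "reach W u w \<inter> F" "reach W w u"] by linarith
  qed
  then have "part_colourable 6 (ind W) (insert {w, u} F \<union> {{v, u}, {v, u'}})"
  proof (rule part_colourable_Un[rotated])
    fix e assume e: "e \<in> {{v, u}, {v, u'}}"
    have *: "card (conflicts (ind W) {v, x}) < 6"
      if "x \<in> W" "x \<in> nb W v" "v \<in> nb W x" "y \<in> nb W v" "y \<noteq> x" "dg W x = 2" "dg W y = 2" for x y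
    proof -
      have "card (reach W v x) + 1 \<le> 2 * (dg W v - 1)"
        using that by (intro card_reach_deg2[OF W that(2), of y]) auto
      moreover have "card (reach W x v) \<le> 2 * (dg W x - 1)"
        using that by (intro card_reach W) auto
      ultimately show ?thesis
        using card_conflicts[OF W that(2)] dg_le_3[OF W] \<open>dg W x = 2\<close> by linarith
    qed
    from e show "card (conflicts (ind W) e) < 6"
      using *[of u u'] *[of u' u] u uW by auto
  qed (use finite_ind in auto)
  moreover have "ind W = insert {w, u} F \<union> {{v, u}, {v, u'}}"
  proof -
    have "(\<lambda>x. {u, x}) ` nb W u = {{v, u}, {w, u}}" using w by (auto simp: insert_commute)
    moreover have "{v, u'} \<in> ind (W - {u})"
      using u uW W nb_irrefl[of v W] by (auto simp: ind_def nb_def)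
    ultimately show ?thesis using ind_remove[OF uW(1)] by (auto simp: F_def)
  qed
  ultimately show ?thesis by simp
qed

lemma six_colours:
  assumes sparse: "\<And>W. W \<subseteq> V \<Longrightarrow> W \<noteq> {} \<Longrightarrow> 6 * card (ind W) < 8 * card W" and "W \<subseteq> V"
  shows "part_colourable 6 (ind W) (ind W)"
  using finite_subset[OF assms(2) finite_V] assms(2)
proof (induction W rule: finite_psubset_induct)
  case (psubset W)
  note W = psubset.prems
  show ?case
  proof (cases "W = {}")
    case True
    then have "ind W = {}" using card_edge[of "{}"] by (auto simp: ind_def)
    then show ?thesis by (simp add: part_colourable_def)
  next
    case False
    have IH: "part_colourable 6 (ind (W - {v})) (ind (W - {v}))" if "v \<in> W" for v
      using psubset that by blast
    show ?thesis
    proof (rule ccontr)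
      assume neg: "\<not> ?thesis"
      have deg: "dg W v = 2 \<or> dg W v = 3" if v: "v \<in> W" for v
      proof (rule ccontr)
        assume "\<not> (dg W v = 2 \<or> dg W v = 3)"
        then have "dg W v \<le> 1" using dg_le_3[OF W v] by linarith
        have "part_colourable 6 (ind W) (ind W)"
        proof (rule delete_vertex[OF W v IH[OF v]])
          fix u assume u: "u \<in> nb W v"
          have "card (reach W v u) = 0" using card_reach[OF W v u] \<open>dg W v \<le> 1\<close> by linarith
          moreover have "card (reach W u v) \<le> 4"
            using u nb_subset nb_sym[OF v u] by (intro card_reach_le_4 W) auto
          ultimately show "card (reach W u v) + card (reach W v u) < 6" by linarith
        qed
        with neg show False by simp
      qed
      define A where "A = {v \<in> W. dg W v = 2}"
      define B where "B = {v \<in> W. dg W v = 3}"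
      have AB: "A \<union> B = W" "A \<inter> B = {}" "A \<subseteq> W" "B \<subseteq> W" using deg by (auto simp: A_def B_def)
      have AA: "nb W v \<inter> B = nb W v" if "v \<in> A" for v
      proof -
        have v: "v \<in> W" "dg W v \<le> 2" using that by (auto simp: A_def)
        have "dg W w \<noteq> 2" if "w \<in> nb W v" for w
          using delete_adjacent_deg2[OF W v that _ IH[OF v(1)]] neg by blast
        then have "w \<in> B" if "w \<in> nb W v" for w
          using that deg[of w] nb_subset[of W v] by (auto simp: B_def)
        then show ?thesis by blast
      qed
      have BA: "card (nb W v \<inter> A) \<le> 1" if v: "v \<in> B" for v
      proof (rule ccontr)
        assume "\<not> card (nb W v \<inter> A) \<le> 1"
        then have "2 \<le> card (nb W v \<inter> A)" by simp
        then obtain T where T: "T \<subseteq> nb W v \<inter> A" "card T = 2" by (rule obtain_subset_with_card_n)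
        then obtain u u' where "T = {u, u'}" "u \<noteq> u'" by (auto simp: card_2_iff)
        with T delete_two_deg2[OF W, of v u u'] IH[of u] neg v show False by (auto simp: A_def B_def)
      qed
      have "(\<Sum>u\<in>A. 2) = (\<Sum>u\<in>A. \<Sum>v\<in>nb W u \<inter> B. 1::nat)" using AA by (auto simp: A_def)
      also have "\<dots> = (\<Sum>v\<in>B. \<Sum>u\<in>nb W v \<inter> A. 1)" by (rule double_count[OF W AB(3,4)])
      also have "\<dots> \<le> (\<Sum>v\<in>B. 1)" using BA by (intro sum_mono) simp
      finally have "2 * card A \<le> card B" by simp
      \<comment> \<open>By \<open>count_deg23\<close> the sparsity bound reads
        \<open>card B < 2 * card A\<close>.\<close>
      then show False
        using sparse[OF W False] count_deg23[OF W deg] unfolding A_def B_def by linarith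
    qed
  qed
qed

section \<open>Reducible configurations for four colours\<close>

text \<open>
  For four colours every vertex \<open>u\<close> of degree at most 2 carries virtual pendant edges, all coloured
  \<open>p u\<close>. This only strengthens the claim, and after deleting vertices the colour \<open>p u\<close> can be given
  to the restored edges at \<open>u\<close> without changing any palette outside the deleted part.
\<close>

definition palette :: "'a set \<Rightarrow> ('a set \<Rightarrow> colour) \<Rightarrow> ('a \<Rightarrow> colour) \<Rightarrow> 'a \<Rightarrow> 'a \<Rightarrow> colour set" where
  "palette W c p u v = (\<lambda>x. c {u, x}) ` (nb W u - {v}) \<union> (if dg W u \<le> 2 then {p u} else {})"

text \<open>Without pendant colours this is injectivity itself, stated for the middle edge
  \<open>uv\<close> instead of for the pair of outer edges.\<close>

definition palette_disjoint :: "'a set \<Rightarrow> ('a set \<Rightarrow> colour) \<Rightarrow> ('a \<Rightarrow> colour) \<Rightarrow> bool" where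
  "palette_disjoint W c p \<longleftrightarrow> (\<forall>u\<in>W. \<forall>v\<in>nb W u. palette W c p u v \<inter> palette W c p v u = {})"

lemma palette_disjoint_part_colourable:
  assumes "palette_disjoint W c p" shows "part_colourable 4 (ind W) (ind W)"
proof -
  obtain h :: "colour \<Rightarrow> nat" where h: "bij_betw h UNIV {1..4}"
    using finite_same_card_bij[of "UNIV :: colour set" "{1..4::nat}"] CARD_colour by auto
  have "h (c e) \<noteq> h (c f)" if ef: "e \<in> ind W" "f \<in> ind W" "f \<in> conflicts (ind W) e" for e f
  proof -
    obtain a b x d where *: "e = {a, b}" "f = {x, d}" "x \<in> nb W b" "a \<noteq> x" "d \<noteq> b"
      using ef(3) by (rule conflictsE)
    then have "a \<in> nb W b" "d \<in> nb W x" "b \<in> W"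
      using ef nb_if_ind by (auto simp: ind_def)
    then have "c {b, a} \<in> palette W c p b x" "c {x, d} \<in> palette W c p x b"
      using * by (auto simp: palette_def)
    moreover have "palette W c p b x \<inter> palette W c p x b = {}"
      using assms \<open>b \<in> W\<close> *(3) by (auto simp: palette_disjoint_def)
    ultimately have "c e \<noteq> c f" using * by (auto simp: insert_commute)
    then show ?thesis using h by (auto simp: bij_betw_def inj_on_def)
  qed
  moreover have "h \<circ> c \<in> ind W \<rightarrow> {1..4}" using h by (auto simp: bij_betw_def)
  ultimately show ?thesis unfolding part_colourable_def by (intro exI[of _ "h \<circ> c"]) auto
qed

text \<open>The pendant colour takes the place of a missing third edge, so it never pushes a palette
  above two colours.\<close>

lemma card_palette:
  assumes "W \<subseteq> V" "u \<in> W" "v \<in> nb W u"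
  shows "card (palette W c p u v) \<le> 2"
proof -
  have fin: "finite (nb W u)" using finite_nb assms(1) by blast
  have "card ((\<lambda>x. c {u, x}) ` (nb W u - {v})) \<le> card (nb W u - {v})"
    using fin by (intro card_image_le) auto
  also have "\<dots> = dg W u - 1" using assms(3) by simp
  finally have "card ((\<lambda>x. c {u, x}) ` (nb W u - {v})) \<le> dg W u - 1" .
  then show ?thesis
    using dg_le_3[OF assms(1,2)] fin by (auto simp: palette_def card_insert_if)
qed

lemma card_compl_palette:
  assumes "W \<subseteq> V" "u \<in> W" "v \<in> nb W u"
  shows "2 \<le> card (- palette W c p u v)"
  using card_palette[OF assms, of c p] card_Compl_colour[of "palette W c p u v"] by linarith

text \<open>A vertex \<open>u\<close> outside \<open>D\<close> with a neighbour in \<open>D\<close>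
  has degree at most 2 in \<open>W - D\<close>, so \<open>p u\<close> already belonged to its
  palettes there. Giving \<open>p u\<close> to its restored edges therefore adds no colour, and only
  edges meeting \<open>D\<close> remain to be checked. As \<open>c0\<close> is fixed before anything
  inside \<open>D\<close> is coloured, the lists for that colouring can be read off from it.\<close>

lemma extend_colouring:
  assumes W: "W \<subseteq> V" and good: "palette_disjoint (W - D) c p"
  obtains c0 where "\<And>c' p'. (\<And>u. u \<in> W - D \<Longrightarrow> p' u = p u) \<Longrightarrow>
      (\<And>u v. u \<in> W - D \<Longrightarrow> v \<in> nb W u \<Longrightarrow> c' {u, v} = c0 {u, v}) \<Longrightarrow>
      (\<And>u v. u \<in> D \<Longrightarrow> v \<in> nb W u \<Longrightarrow> palette W c' p' u v \<inter> palette W c' p' v u = {}) \<Longrightarrow> palette_disjoint W c' p'"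
proof
  \<comment> \<open>For an edge leaving \<open>D\<close> the intersection is the singleton of its
    outer end. Edges inside \<open>D\<close> get an arbitrary value, which \<open>c'\<close> is free
    to replace.\<close>
  define c0 where "c0 e = (if e \<subseteq> W - D then c e else p (the_elem (e \<inter> (W - D))))" for e
  fix c' p'
  assume p': "\<And>u. u \<in> W - D \<Longrightarrow> p' u = p u"
    and c': "\<And>u v. u \<in> W - D \<Longrightarrow> v \<in> nb W u \<Longrightarrow> c' {u, v} = c0 {u, v}"
    and D: "\<And>u v. u \<in> D \<Longrightarrow> v \<in> nb W u \<Longrightarrow> palette W c' p' u v \<inter> palette W c' p' v u = {}"
  have nb_eq: "nb (W - D) u = nb W u - D" for u by (auto simp: nb_def)
  have sub: "palette W c' p' u v \<subseteq> palette (W - D) c p u v" if u: "u \<in> W - D" and v: "v \<notin> D" for u v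
  proof
    fix t assume "t \<in> palette W c' p' u v"
    then consider x where "x \<in> nb W u" "x \<noteq> v" "t = c' {u, x}" | "dg W u \<le> 2" "t = p' u"
      by (auto simp: palette_def split: if_splits)
    then show "t \<in> palette (W - D) c p u v"
    proof cases
      case 1
      have t: "t = c0 {u, x}" using 1 c' u by simp
      show ?thesis
      proof (cases "x \<in> D")
        case False
        then have "x \<in> nb (W - D) u" "{u, x} \<subseteq> W - D" using 1 u nb_subset by (auto simp: nb_eq)
        then have "c {u, x} \<in> palette (W - D) c p u v" using 1(2) by (auto simp: palette_def)
        then show ?thesis using \<open>{u, x} \<subseteq> W - D\<close> by (simp add: t c0_def)
      next
        case True
        then have "{u, x} \<inter> (W - D) = {u}" "\<not> {u, x} \<subseteq> W - D" using u by auto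
        then have "t = p u" unfolding t c0_def by (simp only: if_False the_elem_eq)
        moreover have "nb (W - D) u \<subset> nb W u" using True 1 by (auto simp: nb_eq)
        then have "dg (W - D) u < dg W u" using finite_nb[OF W] by (intro psubset_card_mono)
        then have "dg (W - D) u \<le> 2" using dg_le_3[OF W, of u] u by simp
        ultimately show ?thesis by (simp add: palette_def)
      qed
    next
      case 2
      have "dg (W - D) u \<le> dg W u" using finite_nb[OF W] by (intro card_mono) (auto simp: nb_eq)
      then show ?thesis using 2 p' u by (simp add: palette_def)
    qed
  qed
  show "palette_disjoint W c' p'"
    unfolding palette_disjoint_def
  proof (intro ballI)
    fix u v assume u: "u \<in> W" and v: "v \<in> nb W u"
    consider "u \<in> D" | "v \<in> D" | "u \<notin> D" "v \<notin> D" by blast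
    then show "palette W c' p' u v \<inter> palette W c' p' v u = {}"
    proof cases
      case 1
      then show ?thesis using D v by blast
    next
      case 2
      then show ?thesis using D nb_sym[OF u v] by blast
    next
      case 3
      then have "u \<in> W - D" "v \<in> W - D" "v \<in> nb (W - D) u" using u v nb_subset by (auto simp: nb_eq)
      then have "palette (W - D) c p u v \<inter> palette (W - D) c p v u = {}"
        using good unfolding palette_disjoint_def by blast
      then show ?thesis
        using sub[of u v] sub[of v u] \<open>u \<in> W - D\<close> \<open>v \<in> W - D\<close> by blast
    qed
  qed
qed

lemma palette_cong:
  assumes "p' u = p u" "\<And>v. v \<in> nb W u \<Longrightarrow> c' {u, v} = c {u, v}"
  shows "palette W c' p' u v = palette W c p u v"
proof -
  have "(\<lambda>x. c' {u, x}) ` (nb W u - {v}) = (\<lambda>x. c {u, x}) ` (nb W u - {v})"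
    using assms(2) by (intro image_cong) auto
  then show ?thesis using assms(1) by (simp add: palette_def)
qed

text \<open>The edge at \<open>v\<close> keeps its colour from \<open>c0\<close>; only the pendant
  colour of \<open>v\<close> is chosen, outside the palette of the neighbour.\<close>

lemma reduce_deg1:
  assumes W: "W \<subseteq> V" "v \<in> W" "dg W v \<le> 1" and good: "palette_disjoint (W - {v}) c p"
  shows "\<exists>c p. palette_disjoint W c p"
proof -
  obtain c0 where c0: "\<And>c' p'. (\<And>u. u \<in> W - {v} \<Longrightarrow> p' u = p u) \<Longrightarrow>
      (\<And>u w. u \<in> W - {v} \<Longrightarrow> w \<in> nb W u \<Longrightarrow> c' {u, w} = c0 {u, w}) \<Longrightarrow>
      (\<And>u w. u \<in> {v} \<Longrightarrow> w \<in> nb W u \<Longrightarrow> palette W c' p' u w \<inter> palette W c' p' w u = {}) \<Longrightarrow> palette_disjoint W c' p'"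
    using extend_colouring[OF W(1) good] by blast
  show ?thesis
  proof (cases "nb W v = {}")
    case True
    then have "palette_disjoint W c0 p" by (intro c0) auto
    then show ?thesis by blast
  next
    case False
    then have "dg W v = 1" using W finite_nb[OF W(1)] by (simp add: card_gt_0_iff le_antisym Suc_leI)
    then obtain w where w: "nb W v = {w}" by (auto simp: card_1_singleton_iff)
    then have w': "w \<in> W" "v \<in> nb W w" "w \<noteq> v" using nb_subset[of W v] nb_sym[OF W(2), of w] nb_irrefl[of v W] by auto
    obtain t where t: "t \<in> - palette W c0 p w v"
      using ex_other[OF card_compl_palette[OF W(1) w'(1,2), of c0 p]] by blast
    have "palette W c0 (p(v := t)) v w = {t}" using w by (simp add: palette_def)
    moreover have "palette W c0 (p(v := t)) w v = palette W c0 p w v" using w' by (intro palette_cong) auto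
    ultimately have "palette_disjoint W c0 (p(v := t))" using t w by (intro c0) auto
    then show ?thesis by blast
  qed
qed

lemma reduce_triangle:
  assumes W: "W \<subseteq> V" "v \<in> W" and nb: "nb W x = {v, y}" "nb W y = {v, x}"
    and xy: "x \<in> nb W v" "y \<in> nb W v" "x \<noteq> y" and good: "palette_disjoint (W - {v, x, y}) c p"
  shows "\<exists>c p. palette_disjoint W c p"
proof -
  let ?D = "{v, x, y}"
  obtain c0 where c0: "\<And>c' p'. (\<And>u. u \<in> W - ?D \<Longrightarrow> p' u = p u) \<Longrightarrow>
      (\<And>u w. u \<in> W - ?D \<Longrightarrow> w \<in> nb W u \<Longrightarrow> c' {u, w} = c0 {u, w}) \<Longrightarrow>
      (\<And>u w. u \<in> ?D \<Longrightarrow> w \<in> nb W u \<Longrightarrow> palette W c' p' u w \<inter> palette W c' p' w u = {}) \<Longrightarrow> palette_disjoint W c' p'"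
    using extend_colouring[OF W(1) good] by blast
  have ne: "x \<noteq> v" "y \<noteq> v" using xy nb_irrefl[of v W] by auto
  have fin: "finite (nb W v)" using finite_nb W(1) by blast
  consider "nb W v = {x, y}" | w where "nb W v = {x, y, w}" "w \<notin> ?D"
  proof (cases "nb W v = {x, y}")
    case False
    then obtain w where w: "w \<in> nb W v" "w \<noteq> x" "w \<noteq> y" using xy by blast
    then have "w \<notin> ?D" using nb_irrefl[of v W] by auto
    have "card {x, y, w} = 3" using w xy by auto
    then have "{x, y, w} = nb W v" using dg_le_3[OF W] xy w fin by (intro card_seteq) auto
    with that(2) \<open>w \<notin> ?D\<close> show ?thesis by metis
  qed
  then show ?thesis
  proof cases
    case 1
    \<comment> \<open>With no third neighbour, the pendant colour Red of \<open>v\<close> plays the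
      part of \<open>g\<close>.\<close>
    obtain \<gamma> \<delta> \<epsilon> where col: "\<gamma> \<noteq> Red" "\<gamma> \<noteq> Green" "\<gamma> \<noteq> Blue" "\<delta> \<noteq> Red" "\<delta> \<noteq> Blue" "\<epsilon> \<noteq> Red" "\<epsilon> \<noteq> Green" "\<delta> \<noteq> \<epsilon>"
      using triangle_colours[of Green Blue Red] by auto
    define c' where "c' = c0({v, x} := Green, {v, y} := Blue, {x, y} := \<gamma>)"
    define p' where "p' = p(v := Red, x := \<delta>, y := \<epsilon>)"
    have "palette W c' p' v x = {Blue, Red}" "palette W c' p' v y = {Green, Red}"
      "palette W c' p' x v = {\<gamma>, \<delta>}" "palette W c' p' x y = {Green, \<delta>}"
      "palette W c' p' y v = {\<gamma>, \<epsilon>}" "palette W c' p' y x = {Blue, \<epsilon>}"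
      using nb 1 ne xy(3) by (auto simp: palette_def c'_def p'_def doubleton_eq_iff)
    then have "palette_disjoint W c' p'"
      using nb 1 col by (intro c0) (auto simp: c'_def p'_def doubleton_eq_iff)
    then show ?thesis by blast
  next
    case (2 w)
    have w: "w \<in> W" "v \<in> nb W w" using 2 nb_subset[of W v] nb_sym[OF W(2), of w] by auto
    have S: "2 \<le> card (- palette W c0 p w v)" using card_compl_palette[OF W(1) w] .
    \<comment> \<open>Towards \<open>w\<close>, the palette of \<open>v\<close> is {\<alpha>,
      \<beta>}; the list left by \<open>w\<close> is large enough for two different colours, as
      \<open>triangle_colours\<close> demands.\<close>
    obtain \<alpha> where \<alpha>: "\<alpha> \<in> - palette W c0 p w v" using ex_other[OF S] by blast
    obtain \<beta> where \<beta>: "\<beta> \<in> - palette W c0 p w v" "\<beta> \<noteq> \<alpha>" using ex_other[OF S] by blast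
    define g where "g = c0 {v, w}"
    obtain \<gamma> \<delta> \<epsilon> where col: "\<gamma> \<noteq> g" "\<gamma> \<noteq> \<alpha>" "\<gamma> \<noteq> \<beta>" "\<delta> \<noteq> g" "\<delta> \<noteq> \<beta>" "\<epsilon> \<noteq> g" "\<epsilon> \<noteq> \<alpha>" "\<delta> \<noteq> \<epsilon>"
      using triangle_colours[of \<alpha> \<beta> g] \<beta>(2) by auto
    define c' where "c' = c0({v, x} := \<alpha>, {v, y} := \<beta>, {x, y} := \<gamma>)"
    define p' where "p' = p(x := \<delta>, y := \<epsilon>)"
    have ne': "w \<noteq> v" "w \<noteq> x" "w \<noteq> y" using 2 by auto
    note ne = ne ne' xy(3) ne[symmetric] ne'[symmetric] xy(3)[symmetric]
    have c': "c' {v, x} = \<alpha>" "c' {x, v} = \<alpha>" "c' {v, y} = \<beta>" "c' {y, v} = \<beta>"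
      "c' {x, y} = \<gamma>" "c' {y, x} = \<gamma>" "c' {v, w} = g"
      using ne by (simp_all add: c'_def g_def doubleton_eq_iff)
    have p': "p' x = \<delta>" "p' y = \<epsilon>" using ne by (simp_all add: p'_def)
    have pal: "palette W c' p' v x = {\<beta>, g}" "palette W c' p' v y = {\<alpha>, g}" "palette W c' p' v w = {\<alpha>, \<beta>}"
      "palette W c' p' x v = {\<gamma>, \<delta>}" "palette W c' p' x y = {\<alpha>, \<delta>}"
      "palette W c' p' y v = {\<gamma>, \<epsilon>}" "palette W c' p' y x = {\<beta>, \<epsilon>}"
      using ne by (auto simp: palette_def nb 2 c' p' insert_Diff_if)
    have out: "palette W c' p' w v = palette W c0 p w v"
      using ne by (intro palette_cong) (auto simp: c'_def p'_def doubleton_eq_iff)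
    have "palette_disjoint W c' p'"
    proof (rule c0)
      fix s assume s: "s \<in> W - ?D"
      then show "p' s = p s" by (auto simp: p'_def)
      fix t assume "t \<in> nb W s"
      show "c' {s, t} = c0 {s, t}" using s by (auto simp: c'_def doubleton_eq_iff)
    next
      fix s t assume "s \<in> ?D" and t: "t \<in> nb W s"
      then consider "s = v" | "s = x" | "s = y" by blast
      then show "palette W c' p' s t \<inter> palette W c' p' t s = {}"
        using t col \<alpha> \<beta> by cases (auto simp: nb 2 pal out)
    qed
    then show ?thesis by blast
  qed
qed

text \<open>The case \<open>a = b\<close> is covered: both edges leaving the thread have their
  colours from \<open>c0\<close>, and palettes of outer vertices do not change.\<close>

lemma reduce_thread:
  assumes W: "W \<subseteq> V" "u \<in> W" "v \<in> W" "w \<in> W"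
    and nb: "nb W u = {a, v}" "nb W v = {u, w}" "nb W w = {v, b}"
    and distinct: "distinct [u, v, w]" and ab: "a \<notin> {u, v, w}" "b \<notin> {u, v, w}"
    and good: "palette_disjoint (W - {u, v, w}) c p"
  shows "\<exists>c p. palette_disjoint W c p"
proof -
  let ?D = "{u, v, w}"
  obtain c0 where c0: "\<And>c' p'. (\<And>u. u \<in> W - ?D \<Longrightarrow> p' u = p u) \<Longrightarrow>
      (\<And>u w. u \<in> W - ?D \<Longrightarrow> w \<in> nb W u \<Longrightarrow> c' {u, w} = c0 {u, w}) \<Longrightarrow>
      (\<And>u w. u \<in> ?D \<Longrightarrow> w \<in> nb W u \<Longrightarrow> palette W c' p' u w \<inter> palette W c' p' w u = {}) \<Longrightarrow> palette_disjoint W c' p'"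
    using extend_colouring[OF W(1) good] by blast
  have abW: "a \<in> W" "u \<in> nb W a" "b \<in> W" "w \<in> nb W b"
    using nb nb_subset[of W u] nb_subset[of W w] nb_sym[OF W(2), of a] nb_sym[OF W(4), of b] by auto
  define S where "S = - palette W c0 p a u"
  define T where "T = - palette W c0 p b w"
  have ST: "2 \<le> card S" "2 \<le> card T"
    using card_compl_palette[OF W(1) abW(1,2)] card_compl_palette[OF W(1) abW(3,4)] by (auto simp: S_def T_def)
  define ca where "ca = c0 {u, a}"
  define cb where "cb = c0 {w, b}"
  obtain \<mu> \<pi> \<nu> \<rho> \<tau> where col: "\<mu> \<in> S" "\<pi> \<in> S" "\<nu> \<in> T" "\<rho> \<in> T"
    "\<nu> \<noteq> ca" "\<nu> \<noteq> \<pi>" "\<tau> \<noteq> ca" "\<tau> \<noteq> \<pi>" "\<mu> \<noteq> cb" "\<mu> \<noteq> \<rho>" "\<tau> \<noteq> cb" "\<tau> \<noteq> \<rho>"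
    using thread_lists[OF ST, of ca cb] by blast
  define c' where "c' = c0({u, v} := \<mu>, {v, w} := \<nu>)"
  define p' where "p' = p(u := \<pi>, w := \<rho>, v := \<tau>)"
  have pal: "palette W c' p' u a = {\<mu>, \<pi>}" "palette W c' p' u v = {ca, \<pi>}"
    "palette W c' p' v u = {\<nu>, \<tau>}" "palette W c' p' v w = {\<mu>, \<tau>}"
    "palette W c' p' w v = {cb, \<rho>}" "palette W c' p' w b = {\<nu>, \<rho>}"
    using nb distinct ab by (auto simp: palette_def c'_def p'_def ca_def cb_def doubleton_eq_iff insert_commute)
  have out: "palette W c' p' a u = palette W c0 p a u" "palette W c' p' b w = palette W c0 p b w"
    using ab by (auto intro!: palette_cong simp: c'_def p'_def doubleton_eq_iff)
  have "palette_disjoint W c' p'"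
  proof (rule c0)
    fix s assume s: "s \<in> W - ?D"
    then show "p' s = p s" by (auto simp: p'_def)
    fix t assume "t \<in> nb W s"
    show "c' {s, t} = c0 {s, t}" using s by (auto simp: c'_def doubleton_eq_iff)
  next
    fix s t assume "s \<in> ?D" and t: "t \<in> nb W s"
    then consider "s = u" | "s = v" | "s = w" by blast
    then show "palette W c' p' s t \<inter> palette W c' p' t s = {}"
      using t col by cases (auto simp: nb pal out S_def T_def)
  qed
  then show ?thesis by blast
qed

lemma reduce_branch:
  assumes W: "W \<subseteq> V" "v \<in> W"
    and nb: "nb W v = {x, y, z}" "nb W x = {v, x'}" "nb W x' = {x, a}" "nb W y = {v, y'}" "nb W y' = {y, b}" "nb W z = {v, d}"
    and distinct: "distinct [v, x, x', y, y', z]"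
    and abd: "a \<notin> {v, x, x', y, y', z}" "b \<notin> {v, x, x', y, y', z}" "d \<notin> {v, x, x', y, y', z}"
    and good: "palette_disjoint (W - {v, x, x', y, y', z}) c p"
  shows "\<exists>c p. palette_disjoint W c p"
proof -
  let ?D = "{v, x, x', y, y', z}"
  obtain c0 where c0: "\<And>c' p'. (\<And>u. u \<in> W - ?D \<Longrightarrow> p' u = p u) \<Longrightarrow>
      (\<And>u w. u \<in> W - ?D \<Longrightarrow> w \<in> nb W u \<Longrightarrow> c' {u, w} = c0 {u, w}) \<Longrightarrow>
      (\<And>u w. u \<in> ?D \<Longrightarrow> w \<in> nb W u \<Longrightarrow> palette W c' p' u w \<inter> palette W c' p' w u = {}) \<Longrightarrow> palette_disjoint W c' p'"
    using extend_colouring[OF W(1) good] by blast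
  have DW: "x \<in> W" "y \<in> W" "z \<in> W" "x' \<in> W" "y' \<in> W" "a \<in> W" "b \<in> W" "d \<in> W"
    using nb_subset[of W v] nb_subset[of W x] nb_subset[of W x'] nb_subset[of W y] nb_subset[of W y'] nb_subset[of W z]
    by (simp_all add: nb)
  have abW: "x' \<in> nb W a" "y' \<in> nb W b" "z \<in> nb W d"
    using nb nb_sym[OF DW(4), of a] nb_sym[OF DW(5), of b] nb_sym[OF DW(3), of d] by auto
  define S where "S = - palette W c0 p a x'"
  define T where "T = - palette W c0 p b y'"
  define U where "U = - palette W c0 p d z"
  have "2 \<le> card S" "2 \<le> card T" "2 \<le> card U"
    unfolding S_def T_def U_def using DW abW W(1) by (auto intro: card_compl_palette)
  then have bc: "branch_colouring (c0 {x', a}) (c0 {y', b}) (c0 {z, d}) S T U" by (rule branch_lists)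
  define ca where "ca = c0 {x', a}"
  define cb where "cb = c0 {y', b}"
  define cd where "cd = c0 {z, d}"
  obtain \<alpha> \<beta> \<gamma> \<zeta> where
    col: "\<gamma> \<in> U" "\<zeta> \<in> U" "\<alpha> \<noteq> ca" "\<alpha> \<noteq> cd" "\<beta> \<noteq> cb" "\<beta> \<noteq> cd" "\<zeta> \<noteq> \<alpha>" "\<zeta> \<noteq> \<beta>"
    and side: "side_colouring S ca \<alpha> \<beta> \<gamma>" "side_colouring T cb \<beta> \<alpha> \<gamma>"
    using bc unfolding branch_colouring_def ca_def cb_def cd_def by blast
  obtain \<mu> \<rho> \<pi> where x: "\<mu> \<in> S" "\<rho> \<in> S" "\<mu> \<noteq> \<beta>" "\<mu> \<noteq> \<gamma>" "\<pi> \<noteq> ca" "\<pi> \<noteq> \<beta>" "\<pi> \<noteq> \<gamma>" "\<rho> \<noteq> \<alpha>" "\<rho> \<noteq> \<pi>"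
    using side(1) unfolding side_colouring_def by blast
  obtain \<mu>' \<rho>' \<pi>' where y: "\<mu>' \<in> T" "\<rho>' \<in> T" "\<mu>' \<noteq> \<alpha>" "\<mu>' \<noteq> \<gamma>" "\<pi>' \<noteq> cb" "\<pi>' \<noteq> \<alpha>" "\<pi>' \<noteq> \<gamma>" "\<rho>' \<noteq> \<beta>" "\<rho>' \<noteq> \<pi>'"
    using side(2) unfolding side_colouring_def by blast
  define c' where "c' = c0({v, x} := \<alpha>, {v, y} := \<beta>, {v, z} := \<gamma>, {x, x'} := \<mu>, {y, y'} := \<mu>')"
  define p' where "p' = p(x := \<pi>, x' := \<rho>, y := \<pi>', y' := \<rho>', z := \<zeta>)"
  have ne: "v \<noteq> x" "v \<noteq> x'" "v \<noteq> y" "v \<noteq> y'" "v \<noteq> z" "x \<noteq> x'" "x \<noteq> y" "x \<noteq> y'" "x \<noteq> z" "x' \<noteq> y" "x' \<noteq> y'" "x' \<noteq> z"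
    "y \<noteq> y'" "y \<noteq> z" "y' \<noteq> z"
    "a \<noteq> v" "a \<noteq> x" "a \<noteq> x'" "a \<noteq> y" "a \<noteq> y'" "a \<noteq> z" "b \<noteq> v" "b \<noteq> x" "b \<noteq> x'" "b \<noteq> y" "b \<noteq> y'" "b \<noteq> z"
    "d \<noteq> v" "d \<noteq> x" "d \<noteq> x'" "d \<noteq> y" "d \<noteq> y'" "d \<noteq> z"
    using distinct abd by auto
  note ne = ne ne[symmetric]
  have c': "c' {v, x} = \<alpha>" "c' {x, v} = \<alpha>" "c' {v, y} = \<beta>" "c' {y, v} = \<beta>" "c' {v, z} = \<gamma>" "c' {z, v} = \<gamma>"
    "c' {x, x'} = \<mu>" "c' {x', x} = \<mu>" "c' {y, y'} = \<mu>'" "c' {y', y} = \<mu>'"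
    "c' {x', a} = ca" "c' {y', b} = cb" "c' {z, d} = cd"
    using ne by (simp_all add: c'_def ca_def cb_def cd_def doubleton_eq_iff)
  have p': "p' x = \<pi>" "p' x' = \<rho>" "p' y = \<pi>'" "p' y' = \<rho>'" "p' z = \<zeta>"
    using ne by (simp_all add: p'_def)
  have pal: "palette W c' p' v x = {\<beta>, \<gamma>}" "palette W c' p' v y = {\<alpha>, \<gamma>}" "palette W c' p' v z = {\<alpha>, \<beta>}"
    "palette W c' p' x v = {\<mu>, \<pi>}" "palette W c' p' x x' = {\<alpha>, \<pi>}" "palette W c' p' x' x = {ca, \<rho>}" "palette W c' p' x' a = {\<mu>, \<rho>}"
    "palette W c' p' y v = {\<mu>', \<pi>'}" "palette W c' p' y y' = {\<beta>, \<pi>'}" "palette W c' p' y' y = {cb, \<rho>'}" "palette W c' p' y' b = {\<mu>', \<rho>'}"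
    "palette W c' p' z v = {cd, \<zeta>}" "palette W c' p' z d = {\<gamma>, \<zeta>}"
    using ne by (auto simp: palette_def nb c' p' insert_Diff_if)
  have out: "palette W c' p' a x' = palette W c0 p a x'" "palette W c' p' b y' = palette W c0 p b y'" "palette W c' p' d z = palette W c0 p d z"
    using ne by (auto intro!: palette_cong simp: c'_def p'_def doubleton_eq_iff)
  have "palette_disjoint W c' p'"
  proof (rule c0)
    fix u assume u: "u \<in> W - ?D"
    then show "p' u = p u" by (auto simp: p'_def)
    fix w assume "w \<in> nb W u"
    show "c' {u, w} = c0 {u, w}" using u by (auto simp: c'_def doubleton_eq_iff)
  next
    fix u w assume "u \<in> ?D" and w: "w \<in> nb W u"
    then consider "u = v" | "u = x" | "u = x'" | "u = y" | "u = y'" | "u = z" by blast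
    then show "palette W c' p' u w \<inter> palette W c' p' w u = {}"
      using w col x y by cases (auto simp: nb pal out S_def T_def U_def)
  qed
  then show ?thesis by blast
qed

section \<open>Discharging for four colours\<close>

lemma deg2_other:
  assumes "W \<subseteq> V" "dg W v = 2" "u \<in> nb W v"
  obtains w where "nb W v = {u, w}" "w \<noteq> u" "w \<noteq> v"
proof -
  have "card (nb W v - {u}) = 1" using assms finite_nb by simp
  then obtain w where w: "nb W v - {u} = {w}" by (auto simp: card_1_singleton_iff)
  then have "nb W v = {u, w}" "w \<noteq> u" using assms(3) by auto
  moreover have "w \<noteq> v" using w nb_irrefl[of v W] by auto
  ultimately show ?thesis using that by blast
qed

lemma four_colouring:
  assumes sparse: "\<And>W. W \<subseteq> V \<Longrightarrow> W \<noteq> {} \<Longrightarrow> 6 * card (ind W) < 7 * card W" and "W \<subseteq> V"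
  shows "\<exists>c p. palette_disjoint W c p"
  using finite_subset[OF assms(2) finite_V] assms(2)
proof (induction W rule: finite_psubset_induct)
  case (psubset W)
  note W = psubset.prems
  have IH: "\<exists>c p. palette_disjoint (W - D) c p" if "v \<in> W" "v \<in> D" for D v
    using that W by (intro psubset.IH) auto
  show ?case
  proof (cases "W = {}")
    case True
    then show ?thesis by (auto simp: palette_disjoint_def)
  next
    case False
    show ?thesis
    proof (rule ccontr)
      assume neg: "\<not> ?thesis"
      have deg: "dg W v = 2 \<or> dg W v = 3" if v: "v \<in> W" for v
      proof (rule ccontr)
        assume "\<not> (dg W v = 2 \<or> dg W v = 3)"
        then have "dg W v \<le> 1" using dg_le_3[OF W v] by linarith
        moreover obtain c p where "palette_disjoint (W - {v}) c p" using IH[OF v, of "{v}"] by blast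
        ultimately show False using reduce_deg1[OF W v] neg by blast
      qed
      define A where "A = {v \<in> W. dg W v = 2}"
      define B where "B = {v \<in> W. dg W v = 3}"
      have AB: "A \<union> B = W" "A \<inter> B = {}" "A \<subseteq> W" "B \<subseteq> W" using deg by (auto simp: A_def B_def)
      have inAB: "u \<in> A \<or> u \<in> B" if "u \<in> nb W v" for u v
        using that nb_subset[of W v] AB(1) by blast
      have sym: "u \<in> nb W v \<Longrightarrow> v \<in> nb W u" if "v \<in> W" for u v
        using nb_sym[OF that] .
      have triangle: False
        if x: "x \<in> A" "x \<in> nb W v" and y: "y \<in> A" "y \<in> nb W v" and xy: "y \<in> nb W x" and v: "v \<in> W" for v x y
      proof -
        have ne: "x \<noteq> y" "x \<noteq> v" "y \<noteq> v" using x y xy nb_irrefl by metis+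
        have nb: "v \<in> nb W x" "v \<in> nb W y" "x \<in> nb W y"
          using x y xy v sym AB(3) by blast+
        have "nb W x = {v, y}"
          using x(1) nb xy ne by (intro card_seteq[symmetric] finite_nb[OF W]) (auto simp: A_def)
        moreover have "nb W y = {v, x}"
          using y(1) nb xy ne by (intro card_seteq[symmetric] finite_nb[OF W]) (auto simp: A_def)
        moreover obtain c p where "palette_disjoint (W - {v, x, y}) c p" using IH[OF v, of "{v, x, y}"] by blast
        ultimately show False using reduce_triangle[OF W v _ _ x(2) y(2) ne(1)] neg by blast
      qed
      have thread: "nb W v \<inter> B \<noteq> {}" if v: "v \<in> A" for v
      proof
        assume no: "nb W v \<inter> B = {}"
        have dgv: "dg W v = 2" "v \<in> W" using v by (auto simp: A_def)
        then have "nb W v \<noteq> {}" by auto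
        then obtain u where u: "u \<in> nb W v" by blast
        obtain w where w: "nb W v = {u, w}" "w \<noteq> u" "w \<noteq> v" using deg2_other[OF W dgv(1) u] .
        have uw: "u \<in> A" "w \<in> A" using no w inAB by auto
        then have uwW: "u \<in> W" "w \<in> W" "dg W u = 2" "dg W w = 2" by (auto simp: A_def)
        have vu: "v \<in> nb W u" "v \<in> nb W w" using sym[OF dgv(2)] w by auto
        obtain a where a: "nb W u = {v, a}" "a \<noteq> v" "a \<noteq> u" using deg2_other[OF W uwW(3) vu(1)] .
        obtain b where b: "nb W w = {v, b}" "b \<noteq> v" "b \<noteq> w" using deg2_other[OF W uwW(4) vu(2)] .
        \<comment> \<open>An edge \<open>uw\<close> would close a triangle with two vertices of
          degree 2; excluding it puts \<open>a\<close> and \<open>b\<close> outside the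
          thread.\<close>
        have "w \<notin> nb W u" using triangle[of u v w] uw w dgv(2) by auto
        moreover from this have "u \<notin> nb W w" using sym[OF uwW(2), of u] by blast
        ultimately have ab: "a \<notin> {u, v, w}" "b \<notin> {u, v, w}" using a b by auto
        have "u \<noteq> v" using u nb_irrefl[of v W] by auto
        obtain c p where "palette_disjoint (W - {u, v, w}) c p" using IH[OF uwW(1), of "{u, v, w}"] by blast
        then show False
          using reduce_thread[OF W uwW(1) dgv(2) uwW(2) _ w(1) b(1) _ ab, of c p] a(1) w \<open>u \<noteq> v\<close> neg
          by (auto simp: insert_commute)
      qed
      \<comment> \<open>Discharging in units of 1/6: a vertex of degree 2 needs 2 units, a vertex of degree 3 can spare 4.\<close>
      define f :: "'a \<Rightarrow> nat" where "f u = (if card (nb W u \<inter> B) = 1 then 2 else 1)" for u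
      have give: "2 \<le> (\<Sum>v\<in>nb W u \<inter> B. f u)" if u: "u \<in> A" for u
      proof -
        have "card (nb W u \<inter> B) \<noteq> 0" using thread[OF u] finite_nb[OF W] by simp
        then show ?thesis by (auto simp: f_def)
      qed
      \<comment> \<open>\<open>f x = 2\<close> means that \<open>v\<close> is the only neighbour of
        \<open>x\<close> of degree 3. By \<open>thread\<close> the next vertex \<open>x'\<close>
        must then have one too, so the thread has exactly two vertices of degree 2.\<close>
      have tail: "\<exists>x' a. nb W x = {v, x'} \<and> nb W x' = {x, a} \<and> x' \<in> A \<and> a \<in> B \<and> x' \<noteq> v \<and> x' \<noteq> x"
        if x: "x \<in> A" "f x = 2" and v: "v \<in> B" "x \<in> nb W v" for x v
      proof -
        have xW: "x \<in> W" "dg W x = 2" using x by (auto simp: A_def)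
        have "v \<in> W" using v AB(4) by blast
        then have vx: "v \<in> nb W x" using sym v(2) by blast
        obtain x' where x': "nb W x = {v, x'}" "x' \<noteq> v" "x' \<noteq> x" using deg2_other[OF W xW(2) vx] .
        have "x' \<in> A"
        proof (rule ccontr)
          assume "x' \<notin> A"
          then have "nb W x \<inter> B = {v, x'}" using x' v inAB[of x' x] by auto
          then show False using x(2) x'(2) by (simp add: f_def)
        qed
        then have x'W: "x' \<in> W" "dg W x' = 2" by (auto simp: A_def)
        have "x \<in> nb W x'" using sym[OF xW(1)] x'(1) by blast
        then obtain a where a: "nb W x' = {x, a}" "a \<noteq> x" "a \<noteq> x'" using deg2_other[OF W x'W(2)] by blast
        have "a \<in> B" using thread[OF \<open>x' \<in> A\<close>] a(1) x(1) AB(2) by auto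
        then show ?thesis using x' a \<open>x' \<in> A\<close> by blast
      qed
      have take: "(\<Sum>u\<in>nb W v \<inter> A. f u) \<le> 4" if v: "v \<in> B" for v
      proof (rule ccontr)
        assume large: "\<not> (\<Sum>u\<in>nb W v \<inter> A. f u) \<le> 4"
        have vW: "v \<in> W" "dg W v = 3" using v by (auto simp: B_def)
        have fn: "finite (nb W v)" using finite_nb[OF W] .
        \<comment> \<open>The sum equals the number of neighbours in \<open>A\<close> plus
          \<open>card P\<close>. To exceed 4 with three neighbours, all three must lie in
          \<open>A\<close> and two of them in \<open>P\<close>, which is the configuration of
          \<open>reduce_branch\<close>.\<close>
        define P where "P = {u \<in> nb W v \<inter> A. f u = 2}"
        have "(\<Sum>u\<in>nb W v \<inter> A. f u) = (\<Sum>u\<in>nb W v \<inter> A. 1 + (if f u = 2 then 1 else 0))"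
          by (intro sum.cong) (auto simp: f_def)
        also have "\<dots> = (\<Sum>u\<in>nb W v \<inter> A. 1) + (\<Sum>u\<in>nb W v \<inter> A. if f u = 2 then 1 else 0)"
          by (rule sum.distrib)
        also have "(\<Sum>u\<in>nb W v \<inter> A. if f u = 2 then 1 else 0) = card P"
        proof -
          have "P = nb W v \<inter> A \<inter> {u. f u = 2}" by (auto simp: P_def)
          then show ?thesis using fn by (simp add: sum.If_cases)
        qed
        finally have sum: "(\<Sum>u\<in>nb W v \<inter> A. f u) = card (nb W v \<inter> A) + card P" by simp
        have le: "card P \<le> card (nb W v \<inter> A)" "card (nb W v \<inter> A) \<le> dg W v"
          using fn by (auto simp: P_def intro!: card_mono)
        then have "card (nb W v \<inter> A) = dg W v" "2 \<le> card P" using sum large vW(2) by linarith+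
        then have allA: "nb W v \<subseteq> A" using card_subset_eq[OF fn, of "nb W v \<inter> A"] by auto
        obtain Q where Q: "Q \<subseteq> P" "card Q = 2" using \<open>2 \<le> card P\<close> by (rule obtain_subset_with_card_n)
        then obtain x y where "Q = {x, y}" and xy: "x \<noteq> y" by (auto simp: card_2_iff)
        then have P: "x \<in> nb W v" "y \<in> nb W v" "f x = 2" "f y = 2" using Q by (auto simp: P_def)
        have "card (nb W v - {x, y}) = 1" using fn P xy vW(2) by (simp add: card_Diff_subset)
        then obtain z where z: "nb W v - {x, y} = {z}" by (auto simp: card_1_singleton_iff)
        then have nbv: "nb W v = {x, y, z}" and zne: "z \<noteq> x" "z \<noteq> y" using P by auto
        then have A: "x \<in> A" "y \<in> A" "z \<in> A" using allA by auto
        then have Wd: "x \<in> W" "y \<in> W" "z \<in> W" "dg W z = 2" by (auto simp: A_def)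
        obtain x' a where x': "nb W x = {v, x'}" "nb W x' = {x, a}" "x' \<in> A" "a \<in> B" "x' \<noteq> v" "x' \<noteq> x"
          using tail[OF A(1) P(3) v P(1)] by blast
        obtain y' b where y': "nb W y = {v, y'}" "nb W y' = {y, b}" "y' \<in> A" "b \<in> B" "y' \<noteq> v" "y' \<noteq> y"
          using tail[OF A(2) P(4) v P(2)] by blast
        have x'W: "x' \<in> W" "y' \<in> W" using x'(3) y'(3) AB(3) by auto
        have "v \<in> nb W z" using sym[OF vW(1)] nbv by auto
        then obtain d where d: "nb W z = {v, d}" "d \<noteq> v" "d \<noteq> z" using deg2_other[OF W Wd(4)] by blast
        have vA: "v \<notin> A" using v AB(2) by blast
        have x'nb: "x' \<notin> nb W v" using triangle[of x v x'] A(1) x' P(1) vW(1) by auto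
        have y'nb: "y' \<notin> nb W v" using triangle[of y v y'] A(2) y' P(2) vW(1) by auto
        have x'y': "x' \<noteq> y'"
        proof
          assume "x' = y'"
          then have "y \<in> nb W x'" using y' by simp
          then have "y = a" using x'(2) xy by auto
          then show False using A(2) x'(4) AB(2) by blast
        qed
        have dist: "distinct [v, x, x', y, y', z]"
          using vA A x' y' x'nb y'nb nbv zne xy x'y' by auto
        have "v \<notin> nb W x'" "v \<notin> nb W y'" using x'nb y'nb sym[OF x'W(1)] sym[OF x'W(2)] by blast+
        then have av: "a \<noteq> v" "b \<noteq> v" using x' y' by auto
        \<comment> \<open>The vertex \<open>d\<close> may have degree 2 or 3. It avoids both long
          threads because all neighbours of \<open>x\<close> and \<open>x'\<close> are known and
          \<open>z\<close> is not among them.\<close>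
        have d': "d \<noteq> x" "d \<noteq> x'" if "nb W x = {v, x'}" "nb W x' = {x, a}" "x \<in> W" "x' \<in> W" "x' \<in> A" "a \<in> B" "x' \<noteq> z" "z \<noteq> x" for x x' a
        proof -
          have dz: "d \<in> W \<Longrightarrow> z \<in> nb W d" using sym[OF Wd(3), of d] d(1) by blast
          show "d \<noteq> x" using dz that d Wd(3) A(3) vA by auto
          show "d \<noteq> x'" using dz that A(3) AB(2) by auto
        qed
        have dx: "d \<noteq> x" "d \<noteq> x'"
          using d'[OF x'(1,2) Wd(1) x'W(1) x'(3,4)] dist zne by auto
        have dy: "d \<noteq> y" "d \<noteq> y'"
          using d'[OF y'(1,2) Wd(2) x'W(2) y'(3,4)] dist zne by auto
        have abd: "a \<notin> {v, x, x', y, y', z}" "b \<notin> {v, x, x', y, y', z}" "d \<notin> {v, x, x', y, y', z}"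
          using av A x' y' d dx dy AB(2) by auto
        obtain c p where "palette_disjoint (W - {v, x, x', y, y', z}) c p"
          using IH[OF vW(1), of "{v, x, x', y, y', z}"] by blast
        then show False
          using reduce_branch[OF W vW(1) nbv x'(1,2) y'(1,2) d(1) dist abd] neg by blast
      qed
      have "(\<Sum>u\<in>A. 2) \<le> (\<Sum>u\<in>A. \<Sum>v\<in>nb W u \<inter> B. f u)" using give by (intro sum_mono) auto
      also have "\<dots> = (\<Sum>v\<in>B. \<Sum>u\<in>nb W v \<inter> A. f u)" by (rule double_count[OF W AB(3,4)])
      also have "\<dots> \<le> (\<Sum>v\<in>B. 4)" using take by (intro sum_mono) auto
      finally have "2 * card A \<le> 4 * card B" by simp
      \<comment> \<open>By \<open>count_deg23\<close> the sparsity bound reads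
        \<open>2 * card B < card A\<close>.\<close>
      then show False
        using sparse[OF W False] count_deg23[OF W deg] unfolding A_def B_def by linarith
    qed
  qed
qed

section \<open>From maximum average degree to the theorem\<close>

lemma ind_V: "ind V = E"
  using simple by (auto simp: ind_def simple_graph_def)

text \<open>Clearing denominators turns the real bound into the inequality of natural numbers used
  in the discharging arguments.\<close>

lemma mad_sparse:
  assumes "mad V E < real a / real b" "0 < b" "W \<subseteq> V" "W \<noteq> {}"
  shows "2 * b * card (ind W) < a * card W"
proof -
  have pos: "0 < card W" using assms finite_V finite_subset[of W V] by (auto simp: card_gt_0_iff)
  have "2 * real (card (ind W)) \<le> mad V E * real (card W)" by (rule mad_bound[OF assms(3,4)])
  also have "\<dots> < real a / real b * real (card W)"
    using mult_strict_right_mono[OF assms(1), of "real (card W)"] pos by simp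
  finally have "real (2 * b * card (ind W)) < real (a * card W)"
    using assms(2) by (simp add: field_simps)
  then show ?thesis by (simp only: of_nat_less_iff)
qed

end

theorem theorem1p16:
  fixes V :: "'a set" and E :: "'a set set"
  assumes "simple_graph V E"
    and "subcubic V E"
  shows "(mad V E < 7 / 3 \<longrightarrow> inj_chromatic_index E \<le> 4) \<and>
         (mad V E < 8 / 3 \<longrightarrow> inj_chromatic_index E \<le> 6) \<and>
         (mad V E < 3 \<longrightarrow> inj_chromatic_index E \<le> 7)"
proof -
  interpret subcubic_graph V E using assms by unfold_locales
  have "inj_chromatic_index E \<le> 4" if "mad V E < 7 / 3"
  proof -
    have "\<exists>c p. palette_disjoint V c p"
      by (rule four_colouring) (use mad_sparse[of 7 3] that in auto)
    then show ?thesis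
      using palette_disjoint_part_colourable[of V] part_colourable_all[of 4 E] by (auto simp: ind_V)
  qed
  moreover have "inj_chromatic_index E \<le> 6" if "mad V E < 8 / 3"
  proof -
    have "part_colourable 6 (ind V) (ind V)"
      by (rule six_colours) (use mad_sparse[of 8 3] that in auto)
    then show ?thesis by (simp add: ind_V part_colourable_all)
  qed
  moreover have "inj_chromatic_index E \<le> 7" if "mad V E < 3"
  proof -
    have "part_colourable 7 (ind V) (ind V)"
      by (rule seven_colours) (use mad_sparse[of 3 1] that in auto)
    then show ?thesis by (simp add: ind_V part_colourable_all)
  qed
  ultimately show ?thesis by blast
qed

end
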